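(* Let $\mathbb F$ be an arbitrary field and let $M(x)=[A(x)\,|\,B(x)]$, $x=(x_1,\dots,x_n)$, be a bipartite matrix ($A(x)$ of size $m\times p$, $B(x)$ of size $m\times q$) in which $n$ entries are the unknowns $x_1,\dots,x_n$ (each occurring in exactly one position) and all the other entries are zero. Then there exists a nonzero polynomial $f(x)\in\mathbb F[x_1,\dots,x_n]$ such that all matrices of the family $$\mathcal M_f=\{M(a)\;|\;a\in\mathbb F^n \text{ and } f(a)\neq 0\}$$ reduce by transformations $[A\,|\,B]\mapsto[SAR_1\,|\,SBR_2]$, with nonsingular matrices $S$, $R_1$, $R_2$ over $\mathbb F$, to one and the same matrix $$M_{\rm gen}=[A_{\rm gen}\,|\,B_{\rm gen}]\in\mathcal M_f .$$ Moreover, up to a permutation of columns within $A_{\rm gen}$, a permutation of columns within $B_{\rm gen}$, and a permutation of rows of the whole matrix, $M_{\rm gen}$ has the form $$\left[\begin{array}{ccc|ccc} I_r&0&0&0&I_r&0\\ 0&I_s&0&0&0&0\\ 0&0&0&I_t&0&0\\ 0&0&0&0&0&0\end{array}\right],$$ which is uniquely determined by $M(x)$ due to the equalities $$r+s=r_A,\qquad r+t=r_B,\qquad r+s+t=r_M .$$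
   Context: A bipartite matrix $[A\,|\,B]$ is a block matrix representing a pair $(A,B)$ of matrices with the same number of rows. $I_k$ is the $k\times k$ identity matrix; blocks may be empty. For $a\in\mathbb F^n$, $M(a)$ is the matrix over $\mathbb F$ obtained from $M(x)$ by substituting $a_l$ for $x_l$. Let $\mathbb K=\mathbb F(x_1,\dots,x_n)$ be the field of rational functions; then $r_A=\operatorname{rank}_{\mathbb K}A(x)$, $r_B=\operatorname{rank}_{\mathbb K}B(x)$, $r_M=\operatorname{rank}_{\mathbb K}M(x)$. *)

theory Defs
  imports
    "HOL-Library.Poly_Mapping"
    "HOL-Computational_Algebra.Polynomial_Factorial"
    "HOL-Combinatorics.Permutations"
    "Jordan_Normal_Form.DL_Rank"
begin

text \<open>
  The polynomial ring over \<^typ>\<open>'a\<close> in the indeterminates indexed by \<^typ>\<open>'v\<close>: a polynomial maps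
  each monomial, given by its exponents, to its coefficient. For a finite type \<^typ>\<open>'v\<close> with
  n elements this is the ring in n indeterminates, and \<open>'a ^ n\<close> is \<^typ>\<open>'v \<Rightarrow> 'a\<close>.
  A linear order on \<^typ>\<open>'v\<close> is needed only because the library proves the ring to be an integral
  domain under that assumption; the order itself plays no role.
\<close>

type_synonym ('v, 'a) mpoly = "('v \<Rightarrow>\<^sub>0 nat) \<Rightarrow>\<^sub>0 'a"

definition unknown :: "'v \<Rightarrow> ('v, 'a::zero_neq_one) mpoly" where
  "unknown l = Poly_Mapping.single (Poly_Mapping.single l 1) 1"

definition eval_mpoly :: "('v \<Rightarrow> 'a) \<Rightarrow> ('v, 'a::comm_semiring_1) mpoly \<Rightarrow> 'a" where
  "eval_mpoly a f =
     (\<Sum>e\<in>Poly_Mapping.keys f.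
        Poly_Mapping.lookup f e * (\<Prod>l\<in>Poly_Mapping.keys e. a l ^ Poly_Mapping.lookup e l))"

definition eval_mat :: "('v \<Rightarrow> 'a) \<Rightarrow> ('v, 'a::comm_semiring_1) mpoly mat \<Rightarrow> 'a mat" where
  "eval_mat a M = map_mat (eval_mpoly a) M"

text \<open>The rank over the field of rational functions in the indeterminates \<^typ>\<open>'v\<close>.\<close>

definition generic_rank :: "('v::linorder, 'a::field) mpoly mat \<Rightarrow> nat" where
  "generic_rank M = vec_space.rank (dim_row M) (map_mat to_fract M)"

text \<open>
  A bipartite matrix is handled as the pair of its blocks; \<open>bip_join A B\<close> is the whole matrix
  \<open>[A | B]\<close>.
\<close>

definition bip_join :: "'a::zero mat \<Rightarrow> 'a mat \<Rightarrow> 'a mat" where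
  "bip_join A B = four_block_mat A B (0\<^sub>m 0 (dim_col A)) (0\<^sub>m 0 (dim_col B))"

definition matrix_of_unknowns :: "('v, 'a::zero_neq_one) mpoly mat \<Rightarrow> bool" where
  "matrix_of_unknowns M \<longleftrightarrow>
     (\<forall>l. \<exists>!(i, j). i < dim_row M \<and> j < dim_col M \<and> M $$ (i, j) = unknown l) \<and>
     (\<forall>i < dim_row M. \<forall>j < dim_col M. M $$ (i, j) \<notin> range unknown \<longrightarrow> M $$ (i, j) = 0)"

definition bip_family ::
  "('v, 'a::comm_semiring_1) mpoly mat \<Rightarrow> ('v, 'a) mpoly mat \<Rightarrow> ('v, 'a) mpoly
     \<Rightarrow> ('a mat \<times> 'a mat) set" where
  "bip_family A B f = {(eval_mat a A, eval_mat a B) | a. eval_mpoly a f \<noteq> 0}"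

definition bip_reduces ::
  "nat \<Rightarrow> nat \<Rightarrow> nat \<Rightarrow> 'a::field mat \<times> 'a mat \<Rightarrow> 'a mat \<times> 'a mat \<Rightarrow> bool" where
  "bip_reduces m p q M N \<longleftrightarrow>
     (\<exists>S \<in> carrier_mat m m. \<exists>R1 \<in> carrier_mat p p. \<exists>R2 \<in> carrier_mat q q.
        invertible_mat S \<and> invertible_mat R1 \<and> invertible_mat R2 \<and>
        N = (S * fst M * R1, S * snd M * R2))"

text \<open>
  The two blocks of the canonical matrix. Its row strips have heights \<open>r, s, t, m - r - s - t\<close>;
  the column strips have widths \<open>r, s, p - r - s\<close> on the left and \<open>t, r, q - r - t\<close> on the right.
\<close>

definition canon_left :: "nat \<Rightarrow> nat \<Rightarrow> nat \<Rightarrow> nat \<Rightarrow> 'a::zero_neq_one mat" where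
  "canon_left m p r s = mat m p (\<lambda>(i, j). if i = j \<and> j < r + s then 1 else 0)"

definition canon_right :: "nat \<Rightarrow> nat \<Rightarrow> nat \<Rightarrow> nat \<Rightarrow> nat \<Rightarrow> 'a::zero_neq_one mat" where
  "canon_right m q r s t = mat m q (\<lambda>(i, j).
     if j < t \<and> i = r + s + j \<or> t \<le> j \<and> j < t + r \<and> i = j - t then 1 else 0)"

definition permute_mat :: "(nat \<Rightarrow> nat) \<Rightarrow> (nat \<Rightarrow> nat) \<Rightarrow> 'a mat \<Rightarrow> 'a mat" where
  "permute_mat \<sigma> \<pi> M = mat (dim_row M) (dim_col M) (\<lambda>(i, j). M $$ (\<sigma> i, \<pi> j))"

text \<open>The three inequalities say that the strips fit into an m by (p + q) matrix.\<close>

definition has_canonical_form ::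
  "nat \<Rightarrow> nat \<Rightarrow> nat \<Rightarrow> nat \<Rightarrow> nat \<Rightarrow> nat \<Rightarrow> 'a::zero_neq_one mat \<times> 'a mat \<Rightarrow> bool" where
  "has_canonical_form m p q r s t M \<longleftrightarrow>
     r + s + t \<le> m \<and> r + s \<le> p \<and> r + t \<le> q \<and>
     (\<exists>\<sigma> \<pi> \<rho>. \<sigma> permutes {..<m} \<and> \<pi> permutes {..<p} \<and> \<rho> permutes {..<q} \<and>
        M = (permute_mat \<sigma> \<pi> (canon_left m p r s), permute_mat \<sigma> \<rho> (canon_right m q r s t)))"

end

theory Submission
  imports Defs
begin

text \<open>
  The rank of a matrix is at most the size of a largest matching in its support (a nonzero term in the
  Leibniz expansion of a nonzero minor), and for a matrix of unknowns the generic rank is equal to it.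
  Matchings of \<open>A\<close> and of \<open>B\<close>, both of maximal size, can be chosen such that together they cover \<open>r\<^sub>M\<close>
  rows. Setting the unknowns on these matchings to 1 and all others to 0 gives \<open>M\<^sub>g\<^sub>e\<^sub>n\<close>, which is the
  canonical matrix up to permutations of rows and columns. Let \<open>f\<close> be the product of three minors of
  \<open>A\<close>, \<open>B\<close> and \<open>M\<close> of sizes \<open>r\<^sub>A\<close>, \<open>r\<^sub>B\<close>, \<open>r\<^sub>M\<close> supported on the matchings. At \<open>M\<^sub>g\<^sub>e\<^sub>n\<close> they are
  identity matrices, so \<open>f\<close> takes the value 1 there; and wherever \<open>f\<close> does not vanish, the three ranks
  are the generic ones. Since a bipartite matrix is determined by these three ranks up to the allowed
  transformations, it reduces to \<open>M\<^sub>g\<^sub>e\<^sub>n\<close>.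
\<close>

subsection \<open>Permutation matrices and minors\<close>

text \<open>The field may be finite, so a nonzero polynomial can vanish at every point, and a
  suitable specialisation cannot be deduced from \<open>f\<close> being nonzero. The argument
  therefore starts from an explicit point with coordinates 0 and 1 and builds \<open>f\<close>
  around it: the value 1 there gives at once that \<open>f\<close> is nonzero and that the generic
  matrix belongs to the family. Such points also bound generic ranks from below, because a minor
  that survives evaluation was a nonzero polynomial; matchings in the support bound them from above.
  Maximum matchings of the two blocks chosen independently may overlap in too many rows, which would
  give too small a rank of the whole matrix; this is what the exchange argument prevents. The
  overlap that remains is forced: a row covered on both sides contributes to both blocks
  \<open>I_r\<close>, and its multiplicity is r = r_A + r_B - r_M. The same linear equations recover
  r, s, t from the three ranks of any pair, which is why these ranks classify pairs once every pair
  is known to have a canonical form.\<close>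

text \<open>The index functions need be neither monotone nor injective, so an enumeration of a
  matching can be used directly. This affects a minor at most by its sign, and repeated indices make
  it zero.\<close>

definition subm :: "nat \<Rightarrow> (nat \<Rightarrow> nat) \<Rightarrow> (nat \<Rightarrow> nat) \<Rightarrow> 'a mat \<Rightarrow> 'a mat" where
  "subm k \<rho> \<gamma> C = mat k k (\<lambda>(i, j). C $$ (\<rho> i, \<gamma> j))"

lemma subm_carrier [simp]: "subm k \<rho> \<gamma> C \<in> carrier_mat k k"
  by (simp add: subm_def)

lemma dim_subm [simp]: "dim_row (subm k \<rho> \<gamma> C) = k" "dim_col (subm k \<rho> \<gamma> C) = k"
  by (simp_all add: subm_def)

lemma subm_index [simp]: "i < k \<Longrightarrow> j < k \<Longrightarrow> subm k \<rho> \<gamma> C $$ (i, j) = C $$ (\<rho> i, \<gamma> j)"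
  by (simp add: subm_def)

text \<open>In the finite set \<open>D\<close>, the complements of \<open>S\<close> and of its image
  have equal cardinality, so any bijection between them completes \<open>f\<close>.\<close>

lemma extend_to_permutation:
  fixes f :: "'b \<Rightarrow> 'b"
  assumes "finite D" "S \<subseteq> D" "f ` S \<subseteq> D" "inj_on f S"
  obtains \<pi> where "\<pi> permutes D" "\<And>x. x \<in> S \<Longrightarrow> \<pi> x = f x"
proof -
  have fin: "finite (D - S)" "finite (D - f ` S)" and finS: "finite S"
    using assms finite_subset by auto
  have "card (D - S) = card (D - f ` S)"
    using assms by (simp add: card_Diff_subset card_image finS)
  then obtain g where g: "bij_betw g (D - S) (D - f ` S)"
    using fin finite_same_card_bij by blast
  define \<pi> where "\<pi> x = (if x \<in> S then f x else if x \<in> D then g x else x)" for x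
  have "bij_betw \<pi> S (f ` S)"
    using assms(4) by (auto simp: bij_betw_def \<pi>_def inj_on_def)
  moreover have "bij_betw \<pi> (D - S) (D - f ` S)"
    using g by (rule bij_betw_cong[THEN iffD1, rotated]) (auto simp: \<pi>_def)
  ultimately have "bij_betw \<pi> (S \<union> (D - S)) (f ` S \<union> (D - f ` S))"
    by (rule bij_betw_combine) auto
  then have "bij_betw \<pi> D D"
    using assms by (simp add: Un_absorb1)
  then have "\<pi> permutes D"
    by (rule bij_imp_permutes) (use assms in \<open>auto simp: \<pi>_def\<close>)
  then show ?thesis
    by (rule that) (simp add: \<pi>_def)
qed

section \<open>Invertible matrices over a field\<close>

lemma invertible_iff_det:
  fixes S :: "'a::field mat"
  assumes "S \<in> carrier_mat n n"
  shows "invertible_mat S \<longleftrightarrow> det S \<noteq> 0"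
proof
  assume "invertible_mat S"
  then obtain T where T: "S * T = 1\<^sub>m n" "T * S = 1\<^sub>m (dim_row T)"
    using assms by (auto simp: invertible_mat_def inverts_mat_def)
  have "T \<in> carrier_mat n n"
    using T assms by (metis carrier_matD(1,2) carrier_matI index_mult_mat(2,3) index_one_mat(2,3))
  then have "det S * det T = 1"
    using T(1) det_mult[OF assms, of T] by simp
  then show "det S \<noteq> 0" by auto
next
  assume "det S \<noteq> 0"
  then obtain T where "T \<in> carrier_mat n n" "S * T = 1\<^sub>m n" "T * S = 1\<^sub>m n"
    using det_non_zero_imp_unit[OF assms, of "()"]
    by (auto simp: Units_def ring_mat_simps)
  then show "invertible_mat S"
    using assms by (auto simp: invertible_mat_def inverts_mat_def)
qed

lemma invertible_inverse:
  fixes S :: "'a::field mat"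
  assumes "S \<in> carrier_mat n n" "invertible_mat S"
  obtains T where "T \<in> carrier_mat n n" "invertible_mat T" "S * T = 1\<^sub>m n" "T * S = 1\<^sub>m n"
proof -
  obtain T where T: "T \<in> carrier_mat n n" "S * T = 1\<^sub>m n" "T * S = 1\<^sub>m n"
    using det_non_zero_imp_unit[OF assms(1), of "()"] assms invertible_iff_det
    by (auto simp: Units_def ring_mat_simps)
  moreover have "invertible_mat T"
    using T assms by (auto simp: invertible_mat_def inverts_mat_def)
  ultimately show ?thesis using that by blast
qed

lemma invertible_one: "invertible_mat (1\<^sub>m n :: 'a::field mat)"
  by (subst invertible_iff_det[of _ n]) auto

lemma sandwich_mult:
  fixes C :: "'a::semiring_0 mat"
  assumes "S \<in> carrier_mat m0 m1" "P \<in> carrier_mat m1 m2" "C \<in> carrier_mat m2 c2"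
    "Q \<in> carrier_mat c2 c1" "R \<in> carrier_mat c1 c0"
  shows "S * (P * C * Q) * R = (S * P) * C * (Q * R)"
proof -
  have 1: "(S * P) * C * (Q * R) = (S * P) * C * Q * R"
    using assms by (intro assoc_mult_mat[symmetric]) auto
  have 2: "(S * P) * C = S * (P * C)"
    using assms by (intro assoc_mult_mat) auto
  have 3: "S * (P * C) * Q = S * (P * C * Q)"
    using assms by (intro assoc_mult_mat) auto
  show ?thesis unfolding 1 unfolding 2 unfolding 3 ..
qed

lemma invertible_mult:
  fixes S :: "'a::field mat"
  assumes "S \<in> carrier_mat n n" "T \<in> carrier_mat n n" "invertible_mat S" "invertible_mat T"
  shows "invertible_mat (S * T)"
  using assms by (simp add: invertible_iff_det[of _ n] det_mult)

lemma invertible_block_upper: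
  fixes S :: "'a::field mat"
  assumes "S \<in> carrier_mat k k" "U \<in> carrier_mat k l" "T \<in> carrier_mat l l"
    "invertible_mat S" "invertible_mat T"
  shows "invertible_mat (four_block_mat S U (0\<^sub>m l k) T)"
  using assms
  by (simp add: invertible_iff_det[of _ "k + l"] invertible_iff_det[of _ k] invertible_iff_det[of _ l]
      det_four_block_mat_lower_left_zero[OF assms(1,2) refl assms(3)])

lemma invertible_block_lower:
  fixes S :: "'a::field mat"
  assumes "S \<in> carrier_mat k k" "V \<in> carrier_mat l k" "T \<in> carrier_mat l l"
    "invertible_mat S" "invertible_mat T"
  shows "invertible_mat (four_block_mat S (0\<^sub>m k l) V T)"
  using assms
  by (simp add: invertible_iff_det[of _ "k + l"] invertible_iff_det[of _ k] invertible_iff_det[of _ l]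
      det_four_block_mat_upper_right_zero[OF assms(1) refl assms(2,3)])

section \<open>Permutation matrices\<close>

lemma permutes_less: "\<sigma> permutes {..<n} \<Longrightarrow> i < n \<Longrightarrow> \<sigma> i < (n::nat)"
  by (metis lessThan_iff permutes_in_image)

lemma permute_mat_rows:
  fixes C :: "'a::field mat"
  assumes "\<sigma> permutes {..<m}" "C \<in> carrier_mat m c"
  shows "permute_mat \<sigma> id (1\<^sub>m m) * C = permute_mat \<sigma> id C"
proof (rule eq_matI)
  fix i j assume "i < dim_row (permute_mat \<sigma> id C)" "j < dim_col (permute_mat \<sigma> id C)"
  then have ij: "i < m" "j < c" using assms by (auto simp: permute_mat_def)
  have "(permute_mat \<sigma> id (1\<^sub>m m) * C) $$ (i, j) = (\<Sum>l<m. (if \<sigma> i = l then 1 else 0) * C $$ (l, j))"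
    using assms ij permutes_less[OF assms(1) ij(1)]
    by (simp add: permute_mat_def scalar_prod_def atLeast0LessThan)
  also have "\<dots> = C $$ (\<sigma> i, j)"
    using permutes_less[OF assms(1) ij(1)] by (simp add: if_distrib[of "\<lambda>x. x * _"] cong: if_cong)
  finally show "(permute_mat \<sigma> id (1\<^sub>m m) * C) $$ (i, j) = permute_mat \<sigma> id C $$ (i, j)"
    using assms ij by (simp add: permute_mat_def)
qed (use assms in \<open>auto simp: permute_mat_def\<close>)

lemma permute_mat_cols:
  fixes C :: "'a::field mat"
  assumes "\<sigma> permutes {..<c}" "C \<in> carrier_mat m c"
  shows "C * (permute_mat \<sigma> id (1\<^sub>m c))\<^sup>T = permute_mat id \<sigma> C"
proof (rule eq_matI)
  fix i j assume "i < dim_row (permute_mat id \<sigma> C)" "j < dim_col (permute_mat id \<sigma> C)"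
  then have ij: "i < m" "j < c" using assms by (auto simp: permute_mat_def)
  have "(C * (permute_mat \<sigma> id (1\<^sub>m c))\<^sup>T) $$ (i, j) = (\<Sum>l<c. C $$ (i, l) * (if \<sigma> j = l then 1 else 0))"
    using assms ij permutes_less[OF assms(1) ij(2)]
    by (simp add: permute_mat_def scalar_prod_def atLeast0LessThan)
  also have "\<dots> = C $$ (i, \<sigma> j)"
    using permutes_less[OF assms(1) ij(2)] by (simp add: if_distrib cong: if_cong)
  finally show "(C * (permute_mat \<sigma> id (1\<^sub>m c))\<^sup>T) $$ (i, j) = permute_mat id \<sigma> C $$ (i, j)"
    using assms ij by (simp add: permute_mat_def)
qed (use assms in \<open>auto simp: permute_mat_def\<close>)

lemma permute_mat_carrier [simp]: "C \<in> carrier_mat m c \<Longrightarrow> permute_mat \<sigma> \<pi> C \<in> carrier_mat m c"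
  by (auto simp: permute_mat_def)

lemma permute_one_invertible:
  assumes "\<sigma> permutes {..<m}"
  shows "invertible_mat (permute_mat \<sigma> id (1\<^sub>m m) :: 'a::field mat)"
proof -
  let ?P = "\<lambda>\<sigma>. permute_mat \<sigma> id (1\<^sub>m m) :: 'a mat"
  have inv: "inv_into UNIV \<sigma> permutes {..<m}" using assms by (rule permutes_inv)
  have "?P \<sigma> * ?P (inv_into UNIV \<sigma>) = permute_mat \<sigma> id (?P (inv_into UNIV \<sigma>))"
    using permute_mat_rows[OF assms, of "?P (inv_into UNIV \<sigma>)" m] by simp
  also have "\<dots> = 1\<^sub>m m"
    using permutes_less[OF assms] permutes_inverses[OF assms]
    by (intro eq_matI) (auto simp: permute_mat_def)
  finally have 1: "?P \<sigma> * ?P (inv_into UNIV \<sigma>) = 1\<^sub>m m" .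
  have "det (?P \<sigma>) * det (?P (inv_into UNIV \<sigma>)) = det (?P \<sigma> * ?P (inv_into UNIV \<sigma>))"
    by (subst det_mult[of _ m]) auto
  then have "det (?P \<sigma>) * det (?P (inv_into UNIV \<sigma>)) = 1" unfolding 1 by simp
  then show ?thesis
    by (subst invertible_iff_det[of _ m]) auto
qed

text \<open>The equation for \<open>P\<close> is exported because the two blocks of a pair are
  treated by separate applications with different column permutations: it shows that both obtain the
  same left factor.\<close>

lemma permute_mat_factors:
  assumes "\<sigma> permutes {..<m}" "\<pi> permutes {..<c}"
  obtains P Q :: "'a::field mat" where "P = permute_mat \<sigma> id (1\<^sub>m m)"
    "P \<in> carrier_mat m m" "Q \<in> carrier_mat c c" "invertible_mat P" "invertible_mat Q"
    "\<And>C. C \<in> carrier_mat m c \<Longrightarrow> P * C * Q = permute_mat \<sigma> \<pi> C"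
proof (rule that)
  let ?P = "permute_mat \<sigma> id (1\<^sub>m m) :: 'a mat" and ?Q = "(permute_mat \<pi> id (1\<^sub>m c) :: 'a mat)\<^sup>T"
  show "invertible_mat ?P" by (rule permute_one_invertible[OF assms(1)])
  show "invertible_mat ?Q"
    using permute_one_invertible[OF assms(2), where 'a='a]
    by (simp add: invertible_iff_det[of _ c] det_transpose[of _ c])
  fix C :: "'a mat" assume C: "C \<in> carrier_mat m c"
  have "?P * C * ?Q = permute_mat id \<pi> (permute_mat \<sigma> id C)"
    using permute_mat_rows[OF assms(1) C] permute_mat_cols[OF assms(2) permute_mat_carrier[OF C, of \<sigma> id]] by simp
  also have "\<dots> = permute_mat \<sigma> \<pi> C"
    using C permutes_less[OF assms(1)] permutes_less[OF assms(2)]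
    by (intro eq_matI) (auto simp: permute_mat_def)
  finally show "?P * C * ?Q = permute_mat \<sigma> \<pi> C" .
qed auto

text \<open>A repeated index would produce two equal rows or two equal columns.\<close>

lemma det_subm_inj:
  fixes C :: "'a::field mat"
  assumes "det (subm k \<rho> \<gamma> C) \<noteq> 0"
  shows "inj_on \<rho> {..<k}" "inj_on \<gamma> {..<k}"
proof -
  show "inj_on \<rho> {..<k}"
  proof (rule inj_onI, rule ccontr)
    fix x y assume xy: "x \<in> {..<k}" "y \<in> {..<k}" "\<rho> x = \<rho> y" "x \<noteq> y"
    then have "row (subm k \<rho> \<gamma> C) x = row (subm k \<rho> \<gamma> C) y"
      by (intro eq_vecI) auto
    then have "det (subm k \<rho> \<gamma> C) = 0"
      using xy by (intro det_identical_rows[of _ k x y]) auto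
    then show False using assms by simp
  qed
  show "inj_on \<gamma> {..<k}"
  proof (rule inj_onI, rule ccontr)
    fix x y assume xy: "x \<in> {..<k}" "y \<in> {..<k}" "\<gamma> x = \<gamma> y" "x \<noteq> y"
    then have "col (subm k \<rho> \<gamma> C) x = col (subm k \<rho> \<gamma> C) y"
      by (intro eq_vecI) auto
    then have "det (subm k \<rho> \<gamma> C) = 0"
      using xy by (intro det_identical_columns[of _ k x y]) auto
    then show False using assms by simp
  qed
qed

text \<open>Subtraction is truncated, so the format is \<open>m\<close> by \<open>c\<close> only for
  \<open>k \<le> m\<close> and \<open>k \<le> c\<close>; these bounds accompany the normal form
  throughout.\<close>

definition rank_nf :: "nat \<Rightarrow> nat \<Rightarrow> nat \<Rightarrow> 'a::field mat" where
  "rank_nf m c k = four_block_mat (1\<^sub>m k) (0\<^sub>m k (c - k)) (0\<^sub>m (m - k) k) (0\<^sub>m (m - k) (c - k))"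

text \<open>A nonvanishing minor of maximal size: by maximality, the Schur complement vanishes.\<close>

lemma maximal_minor_normal_form:
  fixes C :: "'a::field mat"
  assumes C: "C \<in> carrier_mat m c"
  obtains k \<rho> \<gamma> S R where
    "\<rho> ` {..<k} \<subseteq> {..<m}" "\<gamma> ` {..<k} \<subseteq> {..<c}" "det (subm k \<rho> \<gamma> C) \<noteq> 0" "k \<le> m" "k \<le> c"
    "S \<in> carrier_mat m m" "R \<in> carrier_mat c c" "invertible_mat S" "invertible_mat R"
    "S * C * R = rank_nf m c k"
proof -
  define good where "good k \<longleftrightarrow> (\<exists>\<rho> \<gamma>. \<rho> ` {..<k} \<subseteq> {..<m} \<and> \<gamma> ` {..<k} \<subseteq> {..<c} \<and> det (subm k \<rho> \<gamma> C) \<noteq> 0)" for k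
  \<comment> \<open>The empty minor has determinant 1, so the zero matrix is covered as
    well.\<close>
  have g0: "good 0"
    by (auto simp: good_def)
  have bound: "k \<le> m" if "good k" for k
  proof -
    from that obtain \<rho> \<gamma> where "\<rho> ` {..<k} \<subseteq> {..<m}" "inj_on \<rho> {..<k}"
      using det_subm_inj by (auto simp: good_def) blast
    then show ?thesis using card_inj_on_le[of \<rho> "{..<k}" "{..<m}"] by simp
  qed
  define k where "k = (GREATEST k. good k)"
  have gk: "good k" unfolding k_def using g0 bound by (rule GreatestI_nat)
  have max: "l \<le> k" if "good l" for l unfolding k_def using that bound by (rule Greatest_le_nat)
  obtain \<rho> \<gamma> where \<rho>: "\<rho> ` {..<k} \<subseteq> {..<m}" and \<gamma>: "\<gamma> ` {..<k} \<subseteq> {..<c}" and d: "det (subm k \<rho> \<gamma> C) \<noteq> 0"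
    using gk by (auto simp: good_def)
  note inj = det_subm_inj[OF d]
  have km: "k \<le> m" using bound gk .
  have kc: "k \<le> c" using card_inj_on_le[OF inj(2) \<gamma>] by simp
  obtain \<sigma> where \<sigma>: "\<sigma> permutes {..<m}" "\<And>x. x < k \<Longrightarrow> \<sigma> x = \<rho> x"
    using extend_to_permutation[of "{..<m}" "{..<k}" \<rho>] \<rho> inj(1) km by auto
  obtain \<pi> where \<pi>: "\<pi> permutes {..<c}" "\<And>x. x < k \<Longrightarrow> \<pi> x = \<gamma> x"
    using extend_to_permutation[of "{..<c}" "{..<k}" \<gamma>] \<gamma> inj(2) kc by auto
  obtain P Q :: "'a mat" where PQ: "P \<in> carrier_mat m m" "Q \<in> carrier_mat c c" "invertible_mat P" "invertible_mat Q"
    "P * C * Q = permute_mat \<sigma> \<pi> C"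
    by (rule permute_mat_factors[OF \<sigma>(1) \<pi>(1)]) (use C in blast)
  define N where "N = subm k \<rho> \<gamma> C"
  define U where "U = mat k (c - k) (\<lambda>(i, j). C $$ (\<sigma> i, \<pi> (k + j)))"
  define V where "V = mat (m - k) k (\<lambda>(i, j). C $$ (\<sigma> (k + i), \<pi> j))"
  define W where "W = mat (m - k) (c - k) (\<lambda>(i, j). C $$ (\<sigma> (k + i), \<pi> (k + j)))"
  have car: "N \<in> carrier_mat k k" "U \<in> carrier_mat k (c - k)" "V \<in> carrier_mat (m - k) k" "W \<in> carrier_mat (m - k) (c - k)"
    by (simp_all add: N_def U_def V_def W_def)
  have D: "permute_mat \<sigma> \<pi> C = four_block_mat N U V W"
    using C km kc \<sigma>(2) \<pi>(2) by (intro eq_matI) (auto simp: permute_mat_def N_def U_def V_def W_def)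
  obtain T where T: "T \<in> carrier_mat k k" "invertible_mat T" "N * T = 1\<^sub>m k" "T * N = 1\<^sub>m k"
    using invertible_inverse[OF car(1)] d invertible_iff_det[OF car(1)] unfolding N_def by metis
  have W: "W = V * T * U"
  proof (rule eq_matI)
    fix i j assume "i < dim_row (V * T * U)" "j < dim_col (V * T * U)"
    then have ij: "i < m - k" "j < c - k" using car T by auto
    \<comment> \<open>The maximal minor is bordered by one further row and column. Writing the
      border as matrices with one column, one row and one entry makes block multiplication
      applicable.\<close>
    define u where "u = mat k 1 (\<lambda>(a, b). U $$ (a, j))"
    define v where "v = mat 1 k (\<lambda>(a, b). V $$ (i, b))"
    define w where "w = mat 1 1 (\<lambda>(a::nat, b::nat). W $$ (i, j))"
    have car': "u \<in> carrier_mat k 1" "v \<in> carrier_mat 1 k" "w \<in> carrier_mat 1 1"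
      by (simp_all add: u_def v_def w_def)
    have vt: "v * T \<in> carrier_mat 1 k" "v * T * u \<in> carrier_mat 1 1" using car' T by auto
    define \<rho>' where "\<rho>' x = (if x < k then \<rho> x else \<sigma> (k + i))" for x
    define \<gamma>' where "\<gamma>' x = (if x < k then \<gamma> x else \<pi> (k + j))" for x
    have "subm (Suc k) \<rho>' \<gamma>' C = four_block_mat N u v w"
      using C ij \<sigma>(2) \<pi>(2) by (intro eq_matI) (auto simp: less_Suc_eq N_def u_def v_def w_def \<rho>'_def \<gamma>'_def U_def V_def W_def)
    moreover have "\<rho>' ` {..<Suc k} \<subseteq> {..<m}" "\<gamma>' ` {..<Suc k} \<subseteq> {..<c}"
      using \<rho> \<gamma> permutes_less[OF \<sigma>(1), of "k + i"] permutes_less[OF \<pi>(1), of "k + j"] ij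
      by (auto simp: \<rho>'_def \<gamma>'_def less_Suc_eq)
    ultimately have z: "det (four_block_mat N u v w) = 0"
      using max[of "Suc k"] unfolding good_def by (metis Suc_n_not_le_n)
    \<comment> \<open>\<open>L\<close> subtracts \<open>v * T\<close> times the upper strip from the
      last row. The result is block triangular with corner \<open>w - v * T * u\<close>, an entry of
      the Schur complement. As the bordered minor is zero and \<open>N\<close> is nonsingular, this
      corner is zero.\<close>
    define L where "L = four_block_mat (1\<^sub>m k) (0\<^sub>m k 1) (- (v * T)) (1\<^sub>m 1 :: 'a mat)"
    have "L * four_block_mat N u v w = four_block_mat (1\<^sub>m k * N + 0\<^sub>m k 1 * v) (1\<^sub>m k * u + 0\<^sub>m k 1 * w)
       (- (v * T) * N + 1\<^sub>m 1 * v) (- (v * T) * u + 1\<^sub>m 1 * w)"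
      unfolding L_def by (rule mult_four_block_mat) (use car car' vt in auto)
    also have "- (v * T) * N + 1\<^sub>m 1 * v = 0\<^sub>m 1 k"
      using car car' vt T by (simp add: assoc_mult_mat[of v 1 k T k N k] uminus_l_inv_mat[of v 1 k])
    also have "- (v * T) * u + 1\<^sub>m 1 * w = w - v * T * u"
      using car' vt by (intro eq_matI) auto
    finally have "L * four_block_mat N u v w = four_block_mat N u (0\<^sub>m 1 k) (w - v * T * u)"
      using car car' vt by simp
    then have "det (L * four_block_mat N u v w) = det N * det (w - v * T * u)"
      using det_four_block_mat_lower_left_zero[OF car(1) car'(1) refl minus_carrier_mat[OF vt(2)]] by simp
    moreover have "det (L * four_block_mat N u v w) = det L * det (four_block_mat N u v w)"
      by (rule det_mult[of _ "k + 1"]) (use car car' vt in \<open>auto simp: L_def\<close>)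
    ultimately have "det (w - v * T * u) = 0"
      using z d by (simp add: N_def)
    then have "(w - v * T * u) $$ (0, 0) = 0"
      using det_single[OF minus_carrier_mat[OF vt(2)], of w] by (metis (no_types))
    then have "w $$ (0, 0) = (v * T * u) $$ (0, 0)"
      using car' vt by simp
    moreover have "row v 0 = row V i"
      using car car' ij by (intro eq_vecI) (auto simp: v_def)
    moreover have "col u 0 = col U j"
      using car car' T ij by (intro eq_vecI) (auto simp: u_def)
    ultimately show "W $$ (i, j) = (V * T * U) $$ (i, j)"
      using ij car car' T vt by (simp add: w_def)
  qed (use car T in auto)
  \<comment> \<open>Block elimination with \<open>T\<close> as the inverse of \<open>N\<close>:
    \<open>S1\<close> turns \<open>N\<close> into the identity and clears \<open>V\<close>, and
    \<open>R1\<close> then clears \<open>T * U\<close>.\<close>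
  define S1 where "S1 = four_block_mat T (0\<^sub>m k (m - k)) (- (V * T)) (1\<^sub>m (m - k))"
  define R1 where "R1 = four_block_mat (1\<^sub>m k) (- (T * U)) (0\<^sub>m (c - k) k) (1\<^sub>m (c - k))"
  have S1: "S1 \<in> carrier_mat (k + (m - k)) (k + (m - k))" "invertible_mat S1"
    unfolding S1_def using car T by (auto intro!: invertible_block_lower invertible_one)
  have R1: "R1 \<in> carrier_mat (k + (c - k)) (k + (c - k))" "invertible_mat R1"
    unfolding R1_def using car T by (auto intro!: invertible_block_upper invertible_one)
  have cars: "T * U \<in> carrier_mat k (c - k)" "V * T \<in> carrier_mat (m - k) k" "V * T * U \<in> carrier_mat (m - k) (c - k)"
    using car T by auto
  have uminus_zero: "- 0\<^sub>m (m - k) (c - k) = (0\<^sub>m (m - k) (c - k) :: 'a mat)"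
    by (intro eq_matI) auto
  have "S1 * four_block_mat N U V W = four_block_mat (T * N + 0\<^sub>m k (m - k) * V) (T * U + 0\<^sub>m k (m - k) * W)
      (- (V * T) * N + 1\<^sub>m (m - k) * V) (- (V * T) * U + 1\<^sub>m (m - k) * W)"
    unfolding S1_def by (rule mult_four_block_mat) (use car T in auto)
  also have "\<dots> = four_block_mat (1\<^sub>m k) (T * U) (0\<^sub>m (m - k) k) (0\<^sub>m (m - k) (c - k))"
    using car T cars
    by (intro cong_four_block_mat) (simp_all add: W assoc_mult_mat[of V "m - k" k T k N k] uminus_l_inv_mat[of _ "m - k"] uminus_zero)
  finally have 1: "S1 * four_block_mat N U V W = \<dots>" .
  have "S1 * four_block_mat N U V W * R1 = four_block_mat (1\<^sub>m k * 1\<^sub>m k + T * U * 0\<^sub>m (c - k) k)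
      (1\<^sub>m k * (- (T * U)) + T * U * 1\<^sub>m (c - k))
      (0\<^sub>m (m - k) k * 1\<^sub>m k + 0\<^sub>m (m - k) (c - k) * 0\<^sub>m (c - k) k)
      (0\<^sub>m (m - k) k * (- (T * U)) + 0\<^sub>m (m - k) (c - k) * 1\<^sub>m (c - k))"
    unfolding 1 R1_def by (rule mult_four_block_mat) (use car T cars in auto)
  also have "\<dots> = rank_nf m c k"
    unfolding rank_nf_def using car T cars
    by (intro cong_four_block_mat) (simp_all add: uminus_l_inv_mat[of _ k] uminus_zero)
  finally have nf: "S1 * permute_mat \<sigma> \<pi> C * R1 = rank_nf m c k" unfolding D .
  have S1': "S1 \<in> carrier_mat m m" and R1': "R1 \<in> carrier_mat c c" using S1 R1 km kc by simp_all
  have "(S1 * P) * C * (Q * R1) = S1 * (P * C * Q) * R1"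
    using sandwich_mult[OF S1' PQ(1) C PQ(2) R1'] by simp
  then have "(S1 * P) * C * (Q * R1) = rank_nf m c k" using nf PQ by simp
  moreover have "invertible_mat (S1 * P)" "invertible_mat (Q * R1)"
    using invertible_mult S1' S1 R1' R1 PQ by blast+
  ultimately show ?thesis
    using that[of \<rho> k \<gamma> "S1 * P" "Q * R1"] \<rho> \<gamma> d km kc S1' R1' PQ by auto
qed

subsection \<open>The rank of a matrix\<close>

text \<open>Padding \<open>Y\<close> with zero rows gives a square matrix whose row \<open>k\<close>
  vanishes. Its transpose kills the unit vector at \<open>k\<close>, so the determinant is zero and
  the padded matrix has a kernel vector, which \<open>Y\<close> kills too.\<close>

lemma wide_kernel:
  fixes Y :: "'a::field mat"
  assumes "Y \<in> carrier_mat k j" "k < j"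
  obtains v where "v \<in> carrier_vec j" "v \<noteq> 0\<^sub>v j" "Y *\<^sub>v v = 0\<^sub>v k"
proof -
  define Y' where "Y' = mat j j (\<lambda>(a, b). if a < k then Y $$ (a, b) else 0)"
  have Y': "Y' \<in> carrier_mat j j" by (simp add: Y'_def)
  have u: "unit_vec j k \<in> carrier_vec j" "unit_vec j k \<noteq> (0\<^sub>v j :: 'a vec)"
    using assms by (auto simp: vec_eq_iff unit_vec_def intro!: exI[of _ k])
  have "Y'\<^sup>T *\<^sub>v unit_vec j k = 0\<^sub>v j"
    using assms by (intro eq_vecI) (auto simp: Y'_def)
  then have "det Y'\<^sup>T = 0"
    using u Y' det_0_iff_vec_prod_zero_field[of "Y'\<^sup>T" j] by (metis transpose_carrier_mat)
  then have "det Y' = 0" using det_transpose[OF Y'] by simp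
  then obtain v where v: "v \<in> carrier_vec j" "v \<noteq> 0\<^sub>v j" "Y' *\<^sub>v v = 0\<^sub>v j"
    using det_0_iff_vec_prod_zero_field[OF Y'] by auto
  have "Y *\<^sub>v v = 0\<^sub>v k"
  proof (rule eq_vecI)
    fix i assume "i < dim_vec (0\<^sub>v k :: 'a vec)"
    then have i: "i < k" by simp
    have "row Y i = row Y' i" using assms i by (intro eq_vecI) (auto simp: Y'_def)
    then have "(Y *\<^sub>v v) $ i = (Y' *\<^sub>v v) $ i" using assms i Y' by simp
    then show "(Y *\<^sub>v v) $ i = 0\<^sub>v k $ i" using v i assms by simp
  qed (use assms in auto)
  with v that show ?thesis by blast
qed

text \<open>A linear relation among the columns selected by \<open>\<gamma>\<close>, restricted to
  the rows selected by \<open>\<rho>\<close>, would give a kernel vector of a nonsingular matrix.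
  Independence concerns the set of columns, so these columns must also be shown distinct before they
  are counted.\<close>

lemma minor_le_rank:
  fixes C :: "'a::field mat"
  assumes C: "C \<in> carrier_mat m c" and \<rho>: "\<rho> ` {..<k} \<subseteq> {..<m}" and \<gamma>: "\<gamma> ` {..<k} \<subseteq> {..<c}"
    and d: "det (subm k \<rho> \<gamma> C) \<noteq> 0"
  shows "k \<le> vec_space.rank m C"
proof -
  interpret vec_space "TYPE('a)" m .
  define C' where "C' = mat m k (\<lambda>(i, j). C $$ (i, \<gamma> j))"
  have C': "C' \<in> carrier_mat m k" by (simp add: C'_def)
  have dist: "distinct (cols C')"
  proof (rule ccontr)
    assume "\<not> distinct (cols C')"
    then obtain x y where xy: "x < k" "y < k" "x \<noteq> y" "col C' x = col C' y"
      using C' unfolding distinct_conv_nth by auto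
    have "C $$ (\<rho> i, \<gamma> x) = C $$ (\<rho> i, \<gamma> y)" if "i < k" for i
    proof -
      have "\<rho> i < m" using \<rho> that by auto
      then have "col C' x $ \<rho> i = C $$ (\<rho> i, \<gamma> x)" "col C' y $ \<rho> i = C $$ (\<rho> i, \<gamma> y)"
        using xy(1,2) by (auto simp: C'_def)
      then show ?thesis using xy(4) by metis
    qed
    then have "col (subm k \<rho> \<gamma> C) x = col (subm k \<rho> \<gamma> C) y"
      using xy by (intro eq_vecI) auto
    then have "det (subm k \<rho> \<gamma> C) = 0"
      using xy by (intro det_identical_columns[of _ k x y]) auto
    then show False using d by simp
  qed
  have li: "lin_indpt (set (cols C'))"
  proof
    assume "lin_dep (set (cols C'))"
    then obtain v where v: "v \<in> carrier_vec k" "v \<noteq> 0\<^sub>v k" "C' *\<^sub>v v = 0\<^sub>v m"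
      using lin_depE[OF C' _ dist] by blast
    have "subm k \<rho> \<gamma> C *\<^sub>v v = 0\<^sub>v k"
    proof (rule eq_vecI)
      fix i assume "i < dim_vec (0\<^sub>v k :: 'a vec)"
      then have i: "i < k" by simp
      then have \<rho>i: "\<rho> i < m" using \<rho> by auto
      have "row (subm k \<rho> \<gamma> C) i = row C' (\<rho> i)"
        using i \<rho>i by (intro eq_vecI) (auto simp: C'_def)
      then have "(subm k \<rho> \<gamma> C *\<^sub>v v) $ i = (C' *\<^sub>v v) $ \<rho> i"
        using i \<rho>i C' by simp
      then show "(subm k \<rho> \<gamma> C *\<^sub>v v) $ i = 0\<^sub>v k $ i"
        using v i \<rho>i by simp
    qed auto
    then show False
      using v d det_0_iff_vec_prod_zero_field[of "subm k \<rho> \<gamma> C" k] by auto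
  qed
  have sub: "set (cols C') \<subseteq> set (cols C)"
  proof
    fix x assume "x \<in> set (cols C')"
    then obtain j where j: "j < k" "x = col C' j" using C' by (auto simp: cols_def)
    have "\<gamma> j < c" using \<gamma> j by auto
    then have "x = col C (\<gamma> j)" using C j by (intro eq_vecI) (auto simp: C'_def)
    then show "x \<in> set (cols C)" using C \<open>\<gamma> j < c\<close> by (auto simp: cols_def)
  qed
  show ?thesis
    using rank_ge_card_indpt[OF C sub li] distinct_card[OF dist] C' by simp
qed

text \<open>A maximal independent set of \<open>l\<close> columns of \<open>X * Y\<close> has the
  form \<open>X * Y'\<close> with \<open>Y'\<close> of size \<open>k\<close> by \<open>l\<close>. If
  \<open>l\<close> exceeded \<open>k\<close>, a kernel vector of \<open>Y'\<close> would be a linear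
  relation among these columns.\<close>

lemma rank_le_inner_dim:
  fixes X Y :: "'a::field mat"
  assumes X: "X \<in> carrier_mat m k" and Y: "Y \<in> carrier_mat k c"
  shows "vec_space.rank m (X * Y) \<le> k"
proof -
  interpret vec_space "TYPE('a)" m .
  define C where "C = X * Y"
  have C: "C \<in> carrier_mat m c" using X Y by (simp add: C_def)
  obtain U where U: "maximal U (\<lambda>T. T \<subseteq> set (cols C) \<and> lin_indpt T)"
    using maximal_exists[of "(\<lambda>T. T \<subseteq> set (cols C) \<and> lin_indpt T)" "card (set (cols C))" "{}"]
    by (meson List.finite_set card_mono empty_iff empty_subsetI finite_lin_indpt2 rev_finite_subset)
  have rk: "rank C = card U" using rank_card_indpt[OF C U] .
  have sub: "U \<subseteq> set (cols C)" and li: "lin_indpt U" using U by (auto simp: maximal_def)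
  have "finite U" using sub finite_subset by blast
  then obtain us where us: "set us = U" "distinct us" using finite_distinct_list by blast
  define l where "l = length us"
  have l: "l = card U" using us distinct_card l_def by fastforce
  have "\<exists>j < c. us ! i = col C j" if "i < l" for i
    using sub us that C by (force simp: cols_def l_def dest: nth_mem)
  then obtain g where g: "\<And>i. i < l \<Longrightarrow> g i < c \<and> us ! i = col C (g i)" by metis
  define C' where "C' = mat m l (\<lambda>(i, j). C $$ (i, g j))"
  have C': "C' \<in> carrier_mat m l" by (simp add: C'_def)
  have "cols C' = us"
  proof (rule nth_equalityI)
    show "length (cols C') = length us" using C' l_def by simp
    fix i assume "i < length (cols C')"
    then have i: "i < l" using C' by simp
    show "cols C' ! i = us ! i"
      using g[OF i] i C by (auto simp: C'_def intro!: eq_vecI)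
  qed
  define Y' where "Y' = mat k l (\<lambda>(i, j). Y $$ (i, g j))"
  have Y': "Y' \<in> carrier_mat k l" by (simp add: Y'_def)
  have fac: "C' = X * Y'"
  proof (rule eq_matI)
    fix i j assume "i < dim_row (X * Y')" "j < dim_col (X * Y')"
    then have ij: "i < m" "j < l" using X Y' by auto
    have "col Y (g j) = col Y' j" using g[OF ij(2)] ij Y by (intro eq_vecI) (auto simp: Y'_def)
    then show "C' $$ (i, j) = (X * Y') $$ (i, j)"
      using ij g[OF ij(2)] X Y Y' by (simp add: C'_def C_def)
  qed (use C' X Y' in auto)
  have "l \<le> k"
  proof (rule ccontr)
    assume "\<not> l \<le> k"
    then obtain v where v: "v \<in> carrier_vec l" "v \<noteq> 0\<^sub>v l" "Y' *\<^sub>v v = 0\<^sub>v k"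
      using wide_kernel[OF Y'] by auto
    have "C' *\<^sub>v v = X *\<^sub>v (Y' *\<^sub>v v)" unfolding fac using X Y' v by (intro assoc_mult_mat_vec)
    also have "\<dots> = 0\<^sub>v m" using X v(3) by (intro eq_vecI) auto
    finally have "lin_dep (set (cols C'))"
      using lin_depI[OF C' v(1,2)] us \<open>cols C' = us\<close> by simp
    then show False using li us \<open>cols C' = us\<close> by simp
  qed
  then show ?thesis using rk l C_def by simp
qed

lemma mult_mult_mult:
  fixes X :: "'a::semiring_0 mat"
  assumes "S \<in> carrier_mat m0 m1" "X \<in> carrier_mat m1 k" "Y \<in> carrier_mat k c1" "R \<in> carrier_mat c1 c0"
  shows "S * (X * Y) * R = (S * X) * (Y * R)"
proof -
  have 1: "S * (X * Y) = (S * X) * Y"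
    using assms by (intro assoc_mult_mat[symmetric]) auto
  have 2: "(S * X) * Y * R = (S * X) * (Y * R)"
    using assms by (intro assoc_mult_mat) auto
  show ?thesis unfolding 1 unfolding 2 ..
qed

text \<open>A factorisation with inner dimension \<open>k\<close>, which makes the upper bound
  \<open>rank_le_inner_dim\<close> applicable to matrices in normal form.\<close>

lemma rank_nf_factor:
  assumes "k \<le> m" "k \<le> c"
  shows "rank_nf m c k = mat m k (\<lambda>(i, j). if i = j then 1 else 0) * (mat k c (\<lambda>(i, j). if i = j then 1 else 0) :: 'a::field mat)"
    (is "_ = ?X * ?Y")
proof (rule eq_matI)
  fix i j assume "i < dim_row (?X * ?Y)" "j < dim_col (?X * ?Y)"
  then have ij: "i < m" "j < c" by auto
  have "(?X * ?Y) $$ (i, j) = (\<Sum>l<k. (if i = l then 1 else 0) * (if l = j then 1 else 0))"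
    using ij by (simp add: scalar_prod_def atLeast0LessThan)
  also have "\<dots> = (\<Sum>l<k. (if l = i then (if i = j then 1 else 0) else 0))"
    by (intro sum.cong) auto
  also have "\<dots> = rank_nf m c k $$ (i, j)"
    using ij assms by (auto simp: rank_nf_def)
  finally show "rank_nf m c k $$ (i, j) = (?X * ?Y) $$ (i, j)" by simp
qed (use assms in \<open>auto simp: rank_nf_def\<close>)

text \<open>The size \<open>k\<close> of a maximal minor is identified with the column rank:
  \<open>minor_le_rank\<close> gives one inequality, and multiplying the factored normal form by the
  inverse transformations writes \<open>C\<close> as a product with inner dimension
  \<open>k\<close>, which gives the other.\<close>

lemma rank_minor_normal_form:
  fixes C :: "'a::field mat"
  assumes C: "C \<in> carrier_mat m c"
  obtains \<rho> \<gamma> S R where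
    "\<rho> ` {..<vec_space.rank m C} \<subseteq> {..<m}" "\<gamma> ` {..<vec_space.rank m C} \<subseteq> {..<c}"
    "det (subm (vec_space.rank m C) \<rho> \<gamma> C) \<noteq> 0" "vec_space.rank m C \<le> m" "vec_space.rank m C \<le> c"
    "S \<in> carrier_mat m m" "R \<in> carrier_mat c c" "invertible_mat S" "invertible_mat R"
    "S * C * R = rank_nf m c (vec_space.rank m C)"
proof -
  obtain k \<rho> \<gamma> S R where *: "\<rho> ` {..<k} \<subseteq> {..<m}" "\<gamma> ` {..<k} \<subseteq> {..<c}" "det (subm k \<rho> \<gamma> C) \<noteq> 0" "k \<le> m" "k \<le> c"
    "S \<in> carrier_mat m m" "R \<in> carrier_mat c c" "invertible_mat S" "invertible_mat R"
    "S * C * R = rank_nf m c k"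
    by (rule maximal_minor_normal_form[OF C])
  obtain S' where S': "S' \<in> carrier_mat m m" "S' * S = 1\<^sub>m m" using invertible_inverse * by metis
  obtain R' where R': "R' \<in> carrier_mat c c" "R * R' = 1\<^sub>m c" using invertible_inverse * by metis
  let ?X = "mat m k (\<lambda>(i, j). if i = j then 1 else 0) :: 'a mat" and ?Y = "mat k c (\<lambda>(i, j). if i = j then 1 else 0) :: 'a mat"
  have cX: "?X \<in> carrier_mat m k" and cY: "?Y \<in> carrier_mat k c" by auto
  have "C = (S' * S) * C * (R * R')" using S' R' C by simp
  also have "\<dots> = S' * (S * C * R) * R'"
    using sandwich_mult[OF S'(1) *(6) C *(7) R'(1)] by simp
  also have "\<dots> = (S' * ?X) * (?Y * R')"
    unfolding *(10) rank_nf_factor[OF *(4,5)]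
    using S'(1) R'(1) cX cY by (intro mult_mult_mult)
  finally have "vec_space.rank m C \<le> k"
    using rank_le_inner_dim[of "S' * ?X" m k "?Y * R'" c] S'(1) R'(1) cX cY by simp
  moreover have "k \<le> vec_space.rank m C" by (rule minor_le_rank[OF C *(1-3)])
  ultimately have k: "k = vec_space.rank m C" by simp
  show ?thesis by (rule that[folded k, OF *])
qed

lemma rank_minor:
  fixes C :: "'a::field mat"
  assumes "C \<in> carrier_mat m c"
  obtains \<rho> \<gamma> where "\<rho> ` {..<vec_space.rank m C} \<subseteq> {..<m}" "\<gamma> ` {..<vec_space.rank m C} \<subseteq> {..<c}"
    "det (subm (vec_space.rank m C) \<rho> \<gamma> C) \<noteq> 0"
  by (rule rank_minor_normal_form[OF assms], rule that)

lemma rank_normal_form: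
  fixes C :: "'a::field mat"
  assumes "C \<in> carrier_mat m c"
  obtains S R where "S \<in> carrier_mat m m" "invertible_mat S" "R \<in> carrier_mat c c" "invertible_mat R"
    "vec_space.rank m C \<le> m" "vec_space.rank m C \<le> c" "S * C * R = rank_nf m c (vec_space.rank m C)"
  by (rule rank_minor_normal_form[OF assms], rule that)

text \<open>Undoing the normal form of \<open>C\<close> writes \<open>S * C * R\<close> as a product
  whose inner dimension is the rank of \<open>C\<close>.\<close>

lemma rank_mult_le:
  fixes C :: "'a::field mat"
  assumes "S \<in> carrier_mat m m" "C \<in> carrier_mat m c" "R \<in> carrier_mat c c"
  shows "vec_space.rank m (S * C * R) \<le> vec_space.rank m C"
proof -
  let ?k = "vec_space.rank m C"
  obtain T Q where T: "T \<in> carrier_mat m m" "invertible_mat T" and Q: "Q \<in> carrier_mat c c" "invertible_mat Q"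
    and le: "?k \<le> m" "?k \<le> c" and nf: "T * C * Q = rank_nf m c ?k"
    by (rule rank_normal_form[OF assms(2)])
  obtain T' where T': "T' \<in> carrier_mat m m" "T' * T = 1\<^sub>m m" using invertible_inverse T by metis
  obtain Q' where Q': "Q' \<in> carrier_mat c c" "Q * Q' = 1\<^sub>m c" using invertible_inverse Q by metis
  let ?X = "mat m ?k (\<lambda>(i, j). if i = j then 1 else 0) :: 'a mat" and ?Y = "mat ?k c (\<lambda>(i, j). if i = j then 1 else 0) :: 'a mat"
  have cX: "?X \<in> carrier_mat m ?k" and cY: "?Y \<in> carrier_mat ?k c" by auto
  have "S * C * R = S * ((T' * T) * C * (Q * Q')) * R" using T' Q' assms by simp
  also have "\<dots> = S * (T' * (T * C * Q) * Q') * R"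
    using sandwich_mult[OF T'(1) T(1) assms(2) Q(1) Q'(1)] by simp
  also have "\<dots> = (S * T') * (T * C * Q) * (Q' * R)"
    using sandwich_mult[OF assms(1) T'(1) _ Q'(1) assms(3), of "T * C * Q"] T Q assms(2) by simp
  also have "\<dots> = (S * T' * ?X) * (?Y * (Q' * R))"
    unfolding nf rank_nf_factor[OF le]
    using mult_carrier_mat[OF assms(1) T'(1)] mult_carrier_mat[OF Q'(1) assms(3)] cX cY
    by (intro mult_mult_mult)
  finally show ?thesis
    using rank_le_inner_dim[of "S * T' * ?X" m ?k "?Y * (Q' * R)" c] T'(1) Q'(1) assms cX cY by simp
qed

lemma rank_equivalent:
  fixes C :: "'a::field mat"
  assumes S: "S \<in> carrier_mat m m" "invertible_mat S" and C: "C \<in> carrier_mat m c"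
    and R: "R \<in> carrier_mat c c" "invertible_mat R"
  shows "vec_space.rank m (S * C * R) = vec_space.rank m C"
proof (rule antisym)
  show "vec_space.rank m (S * C * R) \<le> vec_space.rank m C" by (rule rank_mult_le) fact+
  obtain S' where S': "S' \<in> carrier_mat m m" "S' * S = 1\<^sub>m m" using invertible_inverse S by metis
  obtain R' where R': "R' \<in> carrier_mat c c" "R * R' = 1\<^sub>m c" using invertible_inverse R by metis
  have "C = (S' * S) * C * (R * R')" using S' R' C by simp
  also have "\<dots> = S' * (S * C * R) * R'"
    using sandwich_mult[OF S'(1) S(1) C R(1) R'(1)] by simp
  finally show "vec_space.rank m C \<le> vec_space.rank m (S * C * R)"
    using rank_mult_le[OF S'(1) _ R'(1), of "S * C * R"] S R C by simp
qed

subsection \<open>Reduction of pairs of matrices\<close>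

lemma bip_reducesI:
  assumes "S \<in> carrier_mat m m" "R1 \<in> carrier_mat p p" "R2 \<in> carrier_mat q q"
    "invertible_mat S" "invertible_mat R1" "invertible_mat R2" "A' = S * A * R1" "B' = S * B * R2"
  shows "bip_reduces m p q (A, B) (A', B')"
  using assms by (auto simp: bip_reduces_def)

lemma bip_reducesE:
  assumes "bip_reduces m p q (A, B) (A', B')"
  obtains S R1 R2 where "S \<in> carrier_mat m m" "R1 \<in> carrier_mat p p" "R2 \<in> carrier_mat q q"
    "invertible_mat S" "invertible_mat R1" "invertible_mat R2" "A' = S * A * R1" "B' = S * B * R2"
  using assms by (auto simp: bip_reduces_def)

lemma bip_reduces_trans:
  fixes A B :: "'a::field mat"
  assumes 1: "bip_reduces m p q (A, B) (A', B')" and 2: "bip_reduces m p q (A', B') (A'', B'')"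
    and A: "A \<in> carrier_mat m p" and B: "B \<in> carrier_mat m q"
  shows "bip_reduces m p q (A, B) (A'', B'')"
proof -
  from 1 obtain S R1 R2 where S: "S \<in> carrier_mat m m" "R1 \<in> carrier_mat p p" "R2 \<in> carrier_mat q q"
    "invertible_mat S" "invertible_mat R1" "invertible_mat R2" "A' = S * A * R1" "B' = S * B * R2"
    by (rule bip_reducesE)
  from 2 obtain S' R1' R2' where S': "S' \<in> carrier_mat m m" "R1' \<in> carrier_mat p p" "R2' \<in> carrier_mat q q"
    "invertible_mat S'" "invertible_mat R1'" "invertible_mat R2'" "A'' = S' * A' * R1'" "B'' = S' * B' * R2'"
    by (rule bip_reducesE)
  have "A'' = (S' * S) * A * (R1 * R1')" "B'' = (S' * S) * B * (R2 * R2')"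
    using S S' A B by (simp_all only: sandwich_mult)
  then show ?thesis
    using S S' by (intro bip_reducesI) (auto intro: invertible_mult)
qed

lemma bip_join_carrier: "A \<in> carrier_mat m p \<Longrightarrow> B \<in> carrier_mat m q \<Longrightarrow> bip_join A B \<in> carrier_mat m (p + q)"
  by (auto simp: bip_join_def)

lemma bip_join_index:
  assumes "A \<in> carrier_mat m p" "B \<in> carrier_mat m q" "i < m" "j < p + q"
  shows "bip_join A B $$ (i, j) = (if j < p then A $$ (i, j) else B $$ (i, j - p))"
  using assms by (auto simp: bip_join_def)

text \<open>A reduction of a pair is an equivalence of the joined matrix whose right factor is block
  diagonal. This makes the rank of the joined matrix an invariant beside the ranks of the two
  blocks.\<close>

lemma bip_join_mult:
  fixes A B :: "'a::field mat"
  assumes S: "S \<in> carrier_mat m m" and A: "A \<in> carrier_mat m p" and B: "B \<in> carrier_mat m q"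
    and R1: "R1 \<in> carrier_mat p p" and R2: "R2 \<in> carrier_mat q q"
  shows "bip_join (S * A * R1) (S * B * R2)
    = S * bip_join A B * four_block_mat R1 (0\<^sub>m p q) (0\<^sub>m q p) R2"
proof -
  \<comment> \<open>The joined matrix is a block matrix with an empty lower strip; \<open>S\<close>
    is given empty blocks to match it.\<close>
  have S': "S = four_block_mat S (0\<^sub>m m 0) (0\<^sub>m 0 m) (0\<^sub>m 0 0)"
    using S by (intro eq_matI) auto
  have "four_block_mat S (0\<^sub>m m 0) (0\<^sub>m 0 m) (0\<^sub>m 0 0) * bip_join A B
    = four_block_mat (S * A + 0\<^sub>m m 0 * 0\<^sub>m 0 p) (S * B + 0\<^sub>m m 0 * 0\<^sub>m 0 q)
       (0\<^sub>m 0 m * A + 0\<^sub>m 0 0 * 0\<^sub>m 0 p) (0\<^sub>m 0 m * B + 0\<^sub>m 0 0 * 0\<^sub>m 0 q)"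
    unfolding bip_join_def carrier_matD(2)[OF A] carrier_matD(2)[OF B]
    by (rule mult_four_block_mat) (use S A B in auto)
  also have "\<dots> = four_block_mat (S * A) (S * B) (0\<^sub>m 0 p) (0\<^sub>m 0 q)"
    using S A B by (intro cong_four_block_mat) auto
  finally have 1: "S * bip_join A B = \<dots>" using S' by simp
  have "four_block_mat (S * A) (S * B) (0\<^sub>m 0 p) (0\<^sub>m 0 q) * four_block_mat R1 (0\<^sub>m p q) (0\<^sub>m q p) R2
    = four_block_mat (S * A * R1 + S * B * 0\<^sub>m q p) (S * A * 0\<^sub>m p q + S * B * R2)
       (0\<^sub>m 0 p * R1 + 0\<^sub>m 0 q * 0\<^sub>m q p) (0\<^sub>m 0 p * 0\<^sub>m p q + 0\<^sub>m 0 q * R2)"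
    by (rule mult_four_block_mat) (use S A B R1 R2 in auto)
  also have "\<dots> = four_block_mat (S * A * R1) (S * B * R2) (0\<^sub>m 0 p) (0\<^sub>m 0 q)"
  proof (intro cong_four_block_mat)
    have SA: "S * A \<in> carrier_mat m p" and SB: "S * B \<in> carrier_mat m q" using S A B by auto
    show "S * A * R1 + S * B * 0\<^sub>m q p = S * A * R1"
      unfolding right_mult_zero_mat[OF SB] using SA R1 by (intro right_add_zero_mat[of _ m p]) simp
    show "S * A * 0\<^sub>m p q + S * B * R2 = S * B * R2"
      unfolding right_mult_zero_mat[OF SA] using SB R2 by (intro left_add_zero_mat[of _ m q]) simp
  qed (use R1 R2 in auto)
  finally show ?thesis
    unfolding 1 using R1 R2 S A B by (simp add: bip_join_def)
qed

lemma bip_reduces_rank: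
  fixes A B :: "'a::field mat"
  assumes 1: "bip_reduces m p q (A, B) (A', B')"
    and A: "A \<in> carrier_mat m p" and B: "B \<in> carrier_mat m q"
  shows "vec_space.rank m A' = vec_space.rank m A" "vec_space.rank m B' = vec_space.rank m B"
    "vec_space.rank m (bip_join A' B') = vec_space.rank m (bip_join A B)"
proof -
  from 1 obtain S R1 R2 where S: "S \<in> carrier_mat m m" "R1 \<in> carrier_mat p p" "R2 \<in> carrier_mat q q"
    "invertible_mat S" "invertible_mat R1" "invertible_mat R2" "A' = S * A * R1" "B' = S * B * R2"
    by (rule bip_reducesE)
  show "vec_space.rank m A' = vec_space.rank m A" "vec_space.rank m B' = vec_space.rank m B"
    unfolding S(7,8) using rank_equivalent S A B by blast+
  show "vec_space.rank m (bip_join A' B') = vec_space.rank m (bip_join A B)"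
    unfolding S(7,8) bip_join_mult[OF S(1) A B S(2,3)]
    by (rule rank_equivalent[OF S(1,4) bip_join_carrier[OF A B]])
       (use S invertible_block_upper[of R1 p "0\<^sub>m p q" q R2] in auto)
qed

lemma append_rows_mult:
  fixes X :: "'a::field mat"
  assumes X: "X \<in> carrier_mat k q" and Z: "Z \<in> carrier_mat l q" and R: "R \<in> carrier_mat q c"
  shows "(X @\<^sub>r Z) * R = (X * R) @\<^sub>r (Z * R)"
proof (rule eq_matI)
  have XZ: "X @\<^sub>r Z \<in> carrier_mat (k + l) q" using X Z by simp
  fix i j assume "i < dim_row ((X * R) @\<^sub>r (Z * R))" "j < dim_col ((X * R) @\<^sub>r (Z * R))"
  then have ij: "i < k + l" "j < c" using X Z R by (auto simp: append_rows_def)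
  have "row (X @\<^sub>r Z) i = (if i < k then row X i else row Z (i - k))"
    using X Z ij by (intro eq_vecI) (auto simp: append_rows_def)
  then show "((X @\<^sub>r Z) * R) $$ (i, j) = ((X * R) @\<^sub>r (Z * R)) $$ (i, j)"
    using X Z R ij carrier_matD[OF XZ] by (auto simp: append_rows_def)
qed (use X Z R in \<open>auto simp: append_rows_def\<close>)

lemma block_diag_append_rows:
  fixes X :: "'a::field mat"
  assumes S: "S \<in> carrier_mat k k" and T: "T \<in> carrier_mat l l"
    and X: "X \<in> carrier_mat k q" and Z: "Z \<in> carrier_mat l q"
  shows "four_block_mat S (0\<^sub>m k l) (0\<^sub>m l k) T * (X @\<^sub>r Z) = (S * X) @\<^sub>r (T * Z)"
proof -
  have "four_block_mat S (0\<^sub>m k l) (0\<^sub>m l k) T * four_block_mat X (0\<^sub>m k 0) Z (0\<^sub>m l 0)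
    = four_block_mat (S * X + 0\<^sub>m k l * Z) (S * 0\<^sub>m k 0 + 0\<^sub>m k l * 0\<^sub>m l 0)
       (0\<^sub>m l k * X + T * Z) (0\<^sub>m l k * 0\<^sub>m k 0 + T * 0\<^sub>m l 0)"
    by (rule mult_four_block_mat) (use S T X Z in auto)
  also have "\<dots> = four_block_mat (S * X) (0\<^sub>m k 0) (T * Z) (0\<^sub>m l 0)"
    using S T X Z mult_carrier_mat[OF S X] mult_carrier_mat[OF T Z]
    by (intro cong_four_block_mat) auto
  finally show ?thesis using S T X Z by (simp add: append_rows_def)
qed

lemma rank_nf_carrier: "k \<le> m \<Longrightarrow> k \<le> c \<Longrightarrow> rank_nf m c k \<in> carrier_mat m c"
  by (auto simp: rank_nf_def)

lemma canon_carrier [simp]: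
  "canon_left m p r s \<in> carrier_mat m p" "canon_right m q r s t \<in> carrier_mat m q"
  by (simp_all add: canon_left_def canon_right_def)

text \<open>
  First \<open>A\<close> is brought to rank normal form, then the rows of \<open>B\<close> below the nonzero rows of \<open>A\<close>; their
  pivots clear the columns above them, and what remains of \<open>B\<close> next to the identity block of \<open>A\<close> is
  brought to rank normal form, the row operations on that block being undone by column operations on \<open>A\<close>.
\<close>

lemma bip_normal_form:
  fixes A B :: "'a::field mat"
  assumes A: "A \<in> carrier_mat m p" and B: "B \<in> carrier_mat m q"
  obtains r s t where "r + s + t \<le> m" "r + s \<le> p" "r + t \<le> q"
    "bip_reduces m p q (A, B) (canon_left m p r s, canon_right m q r s t)"
proof -
  define k where "k = vec_space.rank m A"
  obtain S1 R1 where S1: "S1 \<in> carrier_mat m m" "invertible_mat S1" and R1: "R1 \<in> carrier_mat p p" "invertible_mat R1"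
    and k: "k \<le> m" "k \<le> p" and nf1: "S1 * A * R1 = rank_nf m p k"
    by (rule rank_normal_form[OF A, folded k_def])
  define l where "l = m - k"
  have m: "m = k + l" using k by (simp add: l_def)
  define D where "D = four_block_mat (1\<^sub>m k) (0\<^sub>m k (p - k)) (0\<^sub>m l k) (0\<^sub>m l (p - k) :: 'a mat)"
  have D: "D \<in> carrier_mat m p" "rank_nf m p k = D" using k by (auto simp: D_def rank_nf_def l_def)
  define B1 where "B1 = S1 * B"
  have B1: "B1 \<in> carrier_mat m q" using S1 B by (simp add: B1_def)
  have red1: "bip_reduces m p q (A, B) (D, B1)"
    by (rule bip_reducesI[OF S1(1) R1(1) one_carrier_mat S1(2) R1(2) invertible_one])
       (use nf1 D S1 B in \<open>auto simp: B1_def\<close>)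
  \<comment> \<open>\<open>X\<close> consists of the rows beside the identity block of the reduced
    left matrix, \<open>Z\<close> of the rows beside its zero rows.\<close>
  define X where "X = mat k q (\<lambda>(i, j). B1 $$ (i, j))"
  define Z where "Z = mat l q (\<lambda>(i, j). B1 $$ (k + i, j))"
  have X: "X \<in> carrier_mat k q" and Z: "Z \<in> carrier_mat l q" by (simp_all add: X_def Z_def)
  have B1XZ: "B1 = X @\<^sub>r Z"
    using B1 m by (intro eq_matI) (auto simp: append_rows_def X_def Z_def)
  define t where "t = vec_space.rank l Z"
  obtain S2 R2 where S2: "S2 \<in> carrier_mat l l" "invertible_mat S2" and R2: "R2 \<in> carrier_mat q q" "invertible_mat R2"
    and t: "t \<le> l" "t \<le> q" and nf2: "S2 * Z * R2 = rank_nf l q t"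
    by (rule rank_normal_form[OF Z, folded t_def])
  define B2 where "B2 = (X * R2) @\<^sub>r rank_nf l q t"
  define S2' where "S2' = four_block_mat (1\<^sub>m k) (0\<^sub>m k l) (0\<^sub>m l k) S2"
  have S2': "S2' \<in> carrier_mat m m" "invertible_mat S2'"
    unfolding S2'_def m using S2 by (auto intro!: invertible_block_upper invertible_one)
  \<comment> \<open>The lower rows of \<open>D\<close> are zero and absorb \<open>T\<close>, so row
    operations among them are free.\<close>
  have diagD: "four_block_mat Q (0\<^sub>m k l) (0\<^sub>m l k) T * D = four_block_mat Q (0\<^sub>m k (p - k)) (0\<^sub>m l k) (0\<^sub>m l (p - k))"
    if "Q \<in> carrier_mat k k" "T \<in> carrier_mat l l" for Q T
  proof -
    have "four_block_mat Q (0\<^sub>m k l) (0\<^sub>m l k) T * D = four_block_mat (Q * 1\<^sub>m k + 0\<^sub>m k l * 0\<^sub>m l k)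
      (Q * 0\<^sub>m k (p - k) + 0\<^sub>m k l * 0\<^sub>m l (p - k)) (0\<^sub>m l k * 1\<^sub>m k + T * 0\<^sub>m l k)
      (0\<^sub>m l k * 0\<^sub>m k (p - k) + T * 0\<^sub>m l (p - k))"
      unfolding D_def by (rule mult_four_block_mat) (use that in auto)
    also have "\<dots> = four_block_mat Q (0\<^sub>m k (p - k)) (0\<^sub>m l k) (0\<^sub>m l (p - k))"
      using that by (intro cong_four_block_mat) auto
    finally show ?thesis .
  qed
  have "S2' * D = D" unfolding S2'_def using diagD[OF one_carrier_mat S2(1)] by (simp add: D_def)
  have "S2' * B1 * R2 = B2"
    unfolding S2'_def B1XZ block_diag_append_rows[OF one_carrier_mat S2(1) X Z] B2_def nf2[symmetric]
    using append_rows_mult[OF _ mult_carrier_mat[OF S2(1) Z] R2(1), of "1\<^sub>m k * X" k] X by simp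
  have B2: "B2 \<in> carrier_mat m q"
    unfolding B2_def m using X R2 rank_nf_carrier[OF t] by auto
  have red2: "bip_reduces m p q (D, B1) (D, B2)"
    by (rule bip_reducesI[OF S2'(1) one_carrier_mat R2(1) S2'(2) invertible_one R2(2)])
       (use \<open>S2' * D = D\<close> \<open>S2' * B1 * R2 = B2\<close> D in auto)
  define X1 where "X1 = mat k t (\<lambda>(i, j). (X * R2) $$ (i, j))"
  define X2 where "X2 = mat k (q - t) (\<lambda>(i, j). (X * R2) $$ (i, t + j))"
  \<comment> \<open>\<open>E\<close> holds the pivots of the lower strip and \<open>F\<close> is a
    left inverse of it. Hence \<open>X1 * F * E = X1\<close>, and subtracting \<open>X1 * F\<close>
    times the lower strip from the upper one clears \<open>X1\<close>. The left block does not
    change, because its lower strip is zero.\<close>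
  define E where "E = (mat l t (\<lambda>(i, j). if i = j then 1 else 0) :: 'a mat)"
  define F where "F = (mat t l (\<lambda>(i, j). if i = j then 1 else 0) :: 'a mat)"
  have X12: "X1 \<in> carrier_mat k t" "X2 \<in> carrier_mat k (q - t)" and E: "E \<in> carrier_mat l t" and F: "F \<in> carrier_mat t l"
    by (simp_all add: X1_def X2_def E_def F_def)
  have B2': "B2 = four_block_mat X1 X2 E (0\<^sub>m l (q - t))"
    using B2 m t X R2 unfolding B2_def
    by (intro eq_matI) (auto simp: append_rows_def X1_def X2_def E_def rank_nf_def)
  have FE: "F * E = 1\<^sub>m t"
  proof (rule eq_matI)
    fix i j assume "i < dim_row (1\<^sub>m t :: 'a mat)" "j < dim_col (1\<^sub>m t :: 'a mat)"
    then have ij: "i < t" "j < t" by auto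
    have "(F * E) $$ (i, j) = (\<Sum>a<l. (if i = a then 1 else 0) * (if a = j then 1 else 0))"
      using ij t by (simp add: E_def F_def scalar_prod_def atLeast0LessThan)
    also have "\<dots> = (\<Sum>a<l. (if a = i then (if i = j then 1 else 0) else 0))"
      by (intro sum.cong) auto
    also have "\<dots> = (1\<^sub>m t :: 'a mat) $$ (i, j)" using ij t by simp
    finally show "(F * E) $$ (i, j) = (1\<^sub>m t :: 'a mat) $$ (i, j)" .
  qed (use E F in auto)
  define S3 where "S3 = four_block_mat (1\<^sub>m k) (- (X1 * F)) (0\<^sub>m l k) (1\<^sub>m l)"
  have XF: "X1 * F \<in> carrier_mat k l" using X12 F by simp
  have S3: "S3 \<in> carrier_mat m m" "invertible_mat S3"
    unfolding S3_def m using XF by (auto intro!: invertible_block_upper invertible_one)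
  define B3 where "B3 = four_block_mat (0\<^sub>m k t) X2 E (0\<^sub>m l (q - t))"
  have B3: "B3 \<in> carrier_mat m q" using t E unfolding B3_def m by (metis four_block_carrier_mat le_add_diff_inverse zero_carrier_mat)
  have "S3 * D = four_block_mat (1\<^sub>m k * 1\<^sub>m k + - (X1 * F) * 0\<^sub>m l k)
      (1\<^sub>m k * 0\<^sub>m k (p - k) + - (X1 * F) * 0\<^sub>m l (p - k)) (0\<^sub>m l k * 1\<^sub>m k + 1\<^sub>m l * 0\<^sub>m l k)
      (0\<^sub>m l k * 0\<^sub>m k (p - k) + 1\<^sub>m l * 0\<^sub>m l (p - k))"
    unfolding D_def S3_def by (rule mult_four_block_mat) (use XF in auto)
  also have "\<dots> = D"
    unfolding D_def using right_mult_zero_mat[OF uminus_carrier_mat[OF XF]]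
    by (intro cong_four_block_mat) auto
  finally have S3D: "S3 * D = D" .
  have "S3 * B2 = four_block_mat (1\<^sub>m k * X1 + - (X1 * F) * E)
      (1\<^sub>m k * X2 + - (X1 * F) * 0\<^sub>m l (q - t)) (0\<^sub>m l k * X1 + 1\<^sub>m l * E)
      (0\<^sub>m l k * X2 + 1\<^sub>m l * 0\<^sub>m l (q - t))"
    unfolding B2' S3_def
    by (rule mult_four_block_mat[OF one_carrier_mat uminus_carrier_mat[OF XF] zero_carrier_mat one_carrier_mat X12 E zero_carrier_mat])
  also have "\<dots> = B3"
  proof -
    have "- (X1 * F) * E = - (X1 * F * E)"
      by (rule uminus_mult_left_mat) (simp only: carrier_matD[OF XF] carrier_matD[OF E])
    also have "X1 * F * E = X1"
      unfolding assoc_mult_mat[OF X12(1) F E] FE using X12(1) by (rule right_mult_one_mat)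
    finally have 1: "- (X1 * F) * E = - X1" .
    show ?thesis
      unfolding B3_def 1 right_mult_zero_mat[OF uminus_carrier_mat[OF XF]]
    proof (intro cong_four_block_mat)
      show "1\<^sub>m k * X1 + - X1 = 0\<^sub>m k t" using X12(1) by (intro eq_matI) auto
    qed (use X12 E in auto)
  qed
  finally have S3B: "S3 * B2 = B3" .
  have red3: "bip_reduces m p q (D, B2) (D, B3)"
    by (rule bip_reducesI[OF S3(1) one_carrier_mat one_carrier_mat S3(2) invertible_one invertible_one])
       (use S3D S3B D B3 in auto)
  define r where "r = vec_space.rank k X2"
  obtain S4 R4 where S4: "S4 \<in> carrier_mat k k" "invertible_mat S4"
    and R4: "R4 \<in> carrier_mat (q - t) (q - t)" "invertible_mat R4"
    and r: "r \<le> k" "r \<le> q - t" and nf4: "S4 * X2 * R4 = rank_nf k (q - t) r"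
    by (rule rank_normal_form[OF X12(2), folded r_def])
  obtain T4 where T4: "T4 \<in> carrier_mat k k" "invertible_mat T4" "S4 * T4 = 1\<^sub>m k"
    using invertible_inverse S4 by metis
  define S4' where "S4' = four_block_mat S4 (0\<^sub>m k l) (0\<^sub>m l k) (1\<^sub>m l)"
  define T4' where "T4' = four_block_mat T4 (0\<^sub>m k (p - k)) (0\<^sub>m (p - k) k) (1\<^sub>m (p - k))"
  define R4' where "R4' = four_block_mat (1\<^sub>m t) (0\<^sub>m t (q - t)) (0\<^sub>m (q - t) t) R4"
  have S4': "S4' \<in> carrier_mat m m" "invertible_mat S4'"
    unfolding S4'_def m using S4 by (auto intro!: invertible_block_upper invertible_one)
  have T4': "T4' \<in> carrier_mat (k + (p - k)) (k + (p - k))" "invertible_mat T4'"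
    unfolding T4'_def using T4 by (auto intro!: invertible_block_upper invertible_one)
  have R4': "R4' \<in> carrier_mat (t + (q - t)) (t + (q - t))" "invertible_mat R4'"
    unfolding R4'_def using R4 by (auto intro!: invertible_block_upper invertible_one)
  have car4: "T4' \<in> carrier_mat p p" "R4' \<in> carrier_mat q q" using T4' R4' k t by simp_all
  have "S4' * D * T4' = four_block_mat (S4 * T4 + 0\<^sub>m k (p - k) * 0\<^sub>m (p - k) k)
      (S4 * 0\<^sub>m k (p - k) + 0\<^sub>m k (p - k) * 1\<^sub>m (p - k)) (0\<^sub>m l k * T4 + 0\<^sub>m l (p - k) * 0\<^sub>m (p - k) k)
      (0\<^sub>m l k * 0\<^sub>m k (p - k) + 0\<^sub>m l (p - k) * 1\<^sub>m (p - k))"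
    unfolding S4'_def diagD[OF S4(1) one_carrier_mat] T4'_def
    by (rule mult_four_block_mat) (use S4 T4 in auto)
  also have "\<dots> = D"
    unfolding D_def T4(3) using S4 T4 by (intro cong_four_block_mat) auto
  finally have S4D: "S4' * D * T4' = D" .
  define B4 where "B4 = four_block_mat (0\<^sub>m k t) (rank_nf k (q - t) r) E (0\<^sub>m l (q - t))"
  have "S4' * B3 = four_block_mat (S4 * 0\<^sub>m k t + 0\<^sub>m k l * E) (S4 * X2 + 0\<^sub>m k l * 0\<^sub>m l (q - t))
      (0\<^sub>m l k * 0\<^sub>m k t + 1\<^sub>m l * E) (0\<^sub>m l k * X2 + 1\<^sub>m l * 0\<^sub>m l (q - t))"
    unfolding S4'_def B3_def by (rule mult_four_block_mat) (use S4 X12 E in auto)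
  also have "\<dots> = four_block_mat (0\<^sub>m k t) (S4 * X2) E (0\<^sub>m l (q - t))"
    using S4 X12 E mult_carrier_mat[OF S4(1) X12(2)] by (intro cong_four_block_mat) auto
  finally have "S4' * B3 * R4' = four_block_mat (0\<^sub>m k t) (S4 * X2) E (0\<^sub>m l (q - t)) * R4'" by simp
  also have "\<dots> = four_block_mat (0\<^sub>m k t * 1\<^sub>m t + S4 * X2 * 0\<^sub>m (q - t) t) (0\<^sub>m k t * 0\<^sub>m t (q - t) + S4 * X2 * R4)
      (E * 1\<^sub>m t + 0\<^sub>m l (q - t) * 0\<^sub>m (q - t) t) (E * 0\<^sub>m t (q - t) + 0\<^sub>m l (q - t) * R4)"
    unfolding R4'_def by (rule mult_four_block_mat) (use S4 X12 E R4 in auto)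
  also have "\<dots> = B4"
    unfolding B4_def nf4 using right_mult_zero_mat[OF mult_carrier_mat[OF S4(1) X12(2)]] R4 E rank_nf_carrier[OF r, where 'a='a]
    by (intro cong_four_block_mat) auto
  finally have S4B: "S4' * B3 * R4' = B4" .
  have red4: "bip_reduces m p q (D, B3) (D, B4)"
    by (rule bip_reducesI[OF S4'(1) car4 S4'(2) T4'(2) R4'(2)]) (use S4D S4B in auto)
  \<comment> \<open>The \<open>k\<close> rows of the identity block split into the \<open>r\<close>
    rows that also carry a pivot of \<open>X2\<close> and the remaining \<open>k - r\<close>, so the
    latter number is the parameter \<open>s\<close>.\<close>
  have "D = canon_left m p r (k - r)"
    using k r m by (intro eq_matI) (auto simp: D_def canon_left_def)
  moreover have "B4 = canon_right m q r (k - r) t"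
    using k r m t by (intro eq_matI) (auto simp: B4_def canon_right_def E_def rank_nf_def)
  moreover have "bip_reduces m p q (A, B) (D, B4)"
    using red1 red2 red3 red4 A B D B1 B2 B3 by (meson bip_reduces_trans)
  ultimately show ?thesis
    using that[of r "k - r" t] k r m t by simp
qed

subsection \<open>Matchings in the support of a matrix\<close>

definition matching :: "('b \<times> 'c) set \<Rightarrow> bool" where
  "matching N \<longleftrightarrow> finite N \<and> inj_on fst N \<and> inj_on snd N"

lemma matching_rowD: "matching N \<Longrightarrow> (i, j) \<in> N \<Longrightarrow> (i, j') \<in> N \<Longrightarrow> j = j'"
  by (force simp: matching_def inj_on_def)

lemma matching_colD: "matching N \<Longrightarrow> (i, j) \<in> N \<Longrightarrow> (i', j) \<in> N \<Longrightarrow> i = i'"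
  by (force simp: matching_def inj_on_def)

text \<open>
  Among the matchings inside \<open>N \<union> N'\<close> with as many edges as \<open>N'\<close>, one that shares the most edges with
  \<open>N\<close> covers all rows of \<open>N\<close>: an edge of \<open>N\<close> at an uncovered row could be exchanged.
\<close>

lemma matching_extend:
  assumes N: "matching N" and N': "matching N'" and le: "card N \<le> card N'"
  obtains W where "matching W" "W \<subseteq> N \<union> N'" "card W = card N'" "fst ` N \<subseteq> fst ` W"
proof -
  let ?P = "\<lambda>W. matching W \<and> W \<subseteq> N \<union> N' \<and> card W = card N'"
  have fin: "finite N" using N by (simp add: matching_def)
  obtain W where W: "?P W" and max: "\<And>Z. ?P Z \<Longrightarrow> card (N \<inter> Z) \<le> card (N \<inter> W)"
    using ex_has_greatest_nat[of ?P N' "\<lambda>Z. card (N \<inter> Z)" "card N + 1"] N' fin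
    by (auto simp: less_Suc_eq_le intro: card_mono le_SucI)
  have finW: "finite W" and injW: "inj_on fst W" "inj_on snd W" using W by (auto simp: matching_def)
  have "fst ` N \<subseteq> fst ` W"
  proof (rule ccontr)
    assume "\<not> fst ` N \<subseteq> fst ` W"
    then obtain i j where ij: "(i, j) \<in> N" "i \<notin> fst ` W" by force
    \<comment> \<open>The edge given up for \<open>(i, j)\<close>. If \<open>W\<close> uses column
      \<open>j\<close>, it must be the edge there, which is not in \<open>N\<close> because
      \<open>N\<close> already has \<open>(i, j)\<close> in that column. Otherwise any edge outside
      \<open>N\<close> will do; one exists, since \<open>W\<close> is at least as large as
      \<open>N\<close> but misses a row of it. The exchange preserves the size and gains one edge
      shared with \<open>N\<close>.\<close>
    obtain e where e: "e \<in> W" "e \<notin> N" "j \<notin> snd ` (W - {e})"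
    proof (cases "j \<in> snd ` W")
      case True
      then obtain i' where i': "(i', j) \<in> W" by force
      have "(i', j) \<notin> N"
      proof
        assume "(i', j) \<in> N"
        then have "i' = i" by (rule matching_colD[OF N _ ij(1)])
        then show False using i' ij(2) by force
      qed
      moreover have "j \<notin> snd ` (W - {(i', j)})"
      proof
        assume "j \<in> snd ` (W - {(i', j)})"
        then obtain a where "(a, j) \<in> W" "a \<noteq> i'" by force
        then show False using matching_colD[of W a j i'] i' W by simp
      qed
      ultimately show ?thesis using i' that by blast
    next
      case False
      have "\<not> W \<subseteq> N"
        using card_subset_eq[OF fin, of W] card_mono[OF fin, of W] le W ij by force
      then obtain e where "e \<in> W" "e \<notin> N" by auto
      then show ?thesis using False that by blast
    qed
    define Z where "Z = insert (i, j) (W - {e})"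
    have ijW: "(i, j) \<notin> W" using ij(2) by force
    have "inj_on fst Z" "inj_on snd Z"
      unfolding Z_def using ij(2) e(3) injW by (auto simp: inj_on_insert intro: inj_on_diff)
    moreover have "card Z = card N'"
      unfolding Z_def using e(1) ijW finW W card_gt_0_iff[of W] by (auto simp: card_Diff_singleton)
    ultimately have "?P Z"
      using W ij(1) finW by (auto simp: matching_def Z_def)
    moreover have "N \<inter> Z = insert (i, j) (N \<inter> W)"
      using ij(1) e by (auto simp: Z_def)
    moreover have "card (insert (i, j) (N \<inter> W)) = Suc (card (N \<inter> W))"
      using fin ijW by simp
    ultimately show False using max[of Z] by simp
  qed
  with W that show ?thesis by blast
qed

definition support :: "'a::zero mat \<Rightarrow> (nat \<times> nat) set" where
  "support C = {(i, j). i < dim_row C \<and> j < dim_col C \<and> C $$ (i, j) \<noteq> 0}"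

lemma finite_support: "finite (support C)"
  by (rule finite_subset[of _ "{..<dim_row C} \<times> {..<dim_col C}"]) (auto simp: support_def)

lemma rank_matching:
  fixes C :: "'a::field mat"
  assumes C: "C \<in> carrier_mat m c"
  obtains N where "matching N" "N \<subseteq> support C" "card N = vec_space.rank m C"
proof -
  let ?k = "vec_space.rank m C"
  obtain \<rho> \<gamma> where \<rho>: "\<rho> ` {..<?k} \<subseteq> {..<m}" and \<gamma>: "\<gamma> ` {..<?k} \<subseteq> {..<c}"
    and d: "det (subm ?k \<rho> \<gamma> C) \<noteq> 0"
    by (rule rank_minor[OF C])
  note inj = det_subm_inj[OF d]
  obtain p where p: "p permutes {0..<?k}" and "(\<Prod>i = 0..<?k. subm ?k \<rho> \<gamma> C $$ (i, p i)) \<noteq> 0"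
    using d unfolding det_def'[OF subm_carrier] by (metis (mono_tags, lifting) mem_Collect_eq mult_zero_right sum.neutral)
  then have nz: "subm ?k \<rho> \<gamma> C $$ (i, p i) \<noteq> 0" if "i < ?k" for i
    using that by (auto simp: prod_zero_iff)
  have p': "p i < ?k" if "i < ?k" for i using p that permutes_in_image by fastforce
  have pinj: "p i = p j \<longleftrightarrow> i = j" for i j using permutes_inj[OF p] by (auto dest: injD)
  define N where "N = (\<lambda>i. (\<rho> i, \<gamma> (p i))) ` {..<?k}"
  have "inj_on (\<lambda>i. \<gamma> (p i)) {..<?k}"
    using p' pinj by (intro inj_onI) (auto dest!: inj_onD[OF inj(2)])
  then have "matching N"
    using inj(1) unfolding matching_def N_def by (auto intro!: inj_on_imageI simp: comp_def)
  moreover have "N \<subseteq> support C"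
  proof -
    have "(\<rho> i, \<gamma> (p i)) \<in> support C" if "i < ?k" for i
      using nz[OF that] p'[OF that] that image_subset_iff[THEN iffD1, OF \<rho>] image_subset_iff[THEN iffD1, OF \<gamma>] C
      by (simp add: support_def)
    then show ?thesis by (auto simp: N_def)
  qed
  moreover have "card N = ?k"
    unfolding N_def using inj(1) by (subst card_image) (auto simp: inj_on_def)
  ultimately show ?thesis using that by blast
qed

text \<open>A matching as large as the rank uses each row at most once, and only nonzero
  rows.\<close>

lemma rank_le_rows:
  fixes C :: "'a::field mat"
  assumes "C \<in> carrier_mat m c" "finite I" "fst ` support C \<subseteq> I"
  shows "vec_space.rank m C \<le> card I"
proof -
  obtain N where N: "matching N" "N \<subseteq> support C" "card N = vec_space.rank m C"
    using rank_matching[OF assms(1)] .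
  have "card N = card (fst ` N)" using N(1) by (simp add: matching_def card_image)
  also have "\<dots> \<le> card I" using assms N by (intro card_mono) auto
  finally show ?thesis using N by simp
qed

lemma matching_enum:
  assumes "matching N"
  obtains \<rho> \<gamma> where "bij_betw (\<lambda>i. (\<rho> i, \<gamma> i)) {..<card N} N"
proof -
  obtain h where "bij_betw h {..<card N} N"
    using assms ex_bij_betw_nat_finite[of N] by (auto simp: matching_def atLeast0LessThan)
  then have "bij_betw (\<lambda>i. ((fst \<circ> h) i, (snd \<circ> h) i)) {..<card N} N" by simp
  then show ?thesis by (rule that)
qed

definition indicator_mat :: "nat \<Rightarrow> nat \<Rightarrow> (nat \<times> nat) set \<Rightarrow> 'a::zero_neq_one mat" where
  "indicator_mat m c W = mat m c (\<lambda>e. if e \<in> W then 1 else 0)"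

lemma indicator_mat_carrier [simp]: "indicator_mat m c W \<in> carrier_mat m c"
  by (simp add: indicator_mat_def)

text \<open>\<open>W\<close> may be larger than \<open>N\<close> and have several ones in a row.
  Each column has at most one, so in a column used by \<open>N\<close> the edge of \<open>N\<close>
  is the only one. This generality is what the joined matrix requires, where a row can meet both
  blocks.\<close>

lemma matching_minor:
  assumes "bij_betw (\<lambda>i. (\<rho> i, \<gamma> i)) {..<k} N" "N \<subseteq> W" "inj_on snd W" "N \<subseteq> {..<m} \<times> {..<c}" "inj_on fst N"
  shows "subm k \<rho> \<gamma> (indicator_mat m c W) = (1\<^sub>m k :: 'a::zero_neq_one mat)"
proof (rule eq_matI)
  fix i j assume "i < dim_row (1\<^sub>m k :: 'a mat)" "j < dim_col (1\<^sub>m k :: 'a mat)"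
  then have ij: "i < k" "j < k" by auto
  then have mem: "(\<rho> i, \<gamma> i) \<in> N" "(\<rho> j, \<gamma> j) \<in> N" using assms(1) by (auto simp: bij_betw_def)
  have "(\<rho> i, \<gamma> j) \<in> W \<longleftrightarrow> i = j"
  proof
    assume "(\<rho> i, \<gamma> j) \<in> W"
    moreover have "(\<rho> j, \<gamma> j) \<in> W" using mem assms(2) by auto
    ultimately have "\<rho> i = \<rho> j"
      using inj_onD[OF assms(3), of "(\<rho> i, \<gamma> j)" "(\<rho> j, \<gamma> j)"] by simp
    moreover from this have "\<gamma> i = \<gamma> j"
      using mem inj_onD[OF assms(5) _ mem] by simp
    ultimately show "i = j" using assms(1) ij by (auto simp: bij_betw_def inj_on_def)
  qed (use mem assms(2) in auto)
  moreover have "\<rho> i < m" "\<gamma> j < c" using mem assms(4) by auto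
  ultimately show "subm k \<rho> \<gamma> (indicator_mat m c W) $$ (i, j) = (1\<^sub>m k :: 'a mat) $$ (i, j)"
    using ij by (simp add: indicator_mat_def)
qed auto

subsection \<open>Evaluation of polynomial matrices\<close>

definition monomial_value :: "('v \<Rightarrow> 'a) \<Rightarrow> ('v \<Rightarrow>\<^sub>0 nat) \<Rightarrow> 'a::comm_semiring_1" where
  "monomial_value a e = (\<Prod>l\<in>Poly_Mapping.keys e. a l ^ Poly_Mapping.lookup e l)"

lemma monomial_value_superset:
  assumes "finite L" "Poly_Mapping.keys e \<subseteq> L"
  shows "monomial_value a e = (\<Prod>l\<in>L. a l ^ Poly_Mapping.lookup e l)"
  unfolding monomial_value_def using assms
  by (intro prod.mono_neutral_left) (auto simp: in_keys_iff)

lemma monomial_value_add: "monomial_value a (e + e') = monomial_value a e * monomial_value a e'"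
proof -
  let ?L = "Poly_Mapping.keys e \<union> Poly_Mapping.keys e'"
  have L: "finite ?L" "Poly_Mapping.keys e \<subseteq> ?L" "Poly_Mapping.keys e' \<subseteq> ?L" "Poly_Mapping.keys (e + e') \<subseteq> ?L"
    using keys_add[of e e'] by auto
  show ?thesis
    unfolding monomial_value_superset[OF L(1,2)] monomial_value_superset[OF L(1,3)] monomial_value_superset[OF L(1,4)]
    by (simp add: lookup_add power_add prod.distrib)
qed

text \<open>Cancellation can make the keys of \<open>f + g\<close> smaller than the union of the
  keys of \<open>f\<close> and \<open>g\<close>; a common finite index set makes the sums
  comparable.\<close>

lemma eval_mpoly_superset:
  assumes "finite K" "Poly_Mapping.keys f \<subseteq> K"
  shows "eval_mpoly a f = (\<Sum>e\<in>K. Poly_Mapping.lookup f e * monomial_value a e)"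
  unfolding eval_mpoly_def monomial_value_def[symmetric] using assms
  by (intro sum.mono_neutral_left) (auto simp: in_keys_iff)

lemma eval_mpoly_add: "eval_mpoly a (f + g) = eval_mpoly a f + eval_mpoly a g"
proof -
  let ?K = "Poly_Mapping.keys f \<union> Poly_Mapping.keys g"
  have K: "finite ?K" "Poly_Mapping.keys f \<subseteq> ?K" "Poly_Mapping.keys g \<subseteq> ?K" "Poly_Mapping.keys (f + g) \<subseteq> ?K"
    using keys_add[of f g] by auto
  show ?thesis
    unfolding eval_mpoly_superset[OF K(1,2)] eval_mpoly_superset[OF K(1,3)] eval_mpoly_superset[OF K(1,4)]
    by (simp add: lookup_add distrib_right sum.distrib)
qed

lemma eval_mpoly_zero [simp]: "eval_mpoly a 0 = 0"
  by (simp add: eval_mpoly_def)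

lemma eval_mpoly_single: "eval_mpoly a (Poly_Mapping.single e c) = c * monomial_value a e"
  using eval_mpoly_superset[of "{e}" "Poly_Mapping.single e c" a] by simp

lemma eval_mpoly_sum: "eval_mpoly a (sum g X) = (\<Sum>x\<in>X. eval_mpoly a (g x))"
  by (induction X rule: infinite_finite_induct) (simp_all add: eval_mpoly_add)

lemma mpoly_expansion:
  fixes f :: "('v, 'a::comm_semiring_1) mpoly"
  shows "f = (\<Sum>e\<in>Poly_Mapping.keys f. Poly_Mapping.single e (Poly_Mapping.lookup f e))"
  by (rule poly_mapping_eqI)
     (simp add: lookup_sum lookup_single when_def in_keys_iff)

lemma eval_mpoly_mult: "eval_mpoly a (f * g) = eval_mpoly a f * eval_mpoly a g"
proof -
  have "f * g = (\<Sum>e\<in>Poly_Mapping.keys f. Poly_Mapping.single e (Poly_Mapping.lookup f e))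
      * (\<Sum>e\<in>Poly_Mapping.keys g. Poly_Mapping.single e (Poly_Mapping.lookup g e))"
    using mpoly_expansion[of f] mpoly_expansion[of g] by simp
  also have "eval_mpoly a \<dots> = (\<Sum>e\<in>Poly_Mapping.keys f. \<Sum>e'\<in>Poly_Mapping.keys g.
      (Poly_Mapping.lookup f e * monomial_value a e) * (Poly_Mapping.lookup g e' * monomial_value a e'))"
    by (simp add: sum_product eval_mpoly_sum mult_single eval_mpoly_single monomial_value_add ac_simps)
  also have "\<dots> = eval_mpoly a f * eval_mpoly a g"
    by (simp add: sum_product eval_mpoly_superset[OF finite_keys order_refl])
  finally show ?thesis .
qed

lemma eval_mpoly_unknown: "eval_mpoly a (unknown l) = a l"
  by (simp add: unknown_def eval_mpoly_single monomial_value_def)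

lemma eval_mpoly_hom: "comm_ring_hom (eval_mpoly a :: ('v, 'a::comm_ring_1) mpoly \<Rightarrow> 'a)"
proof
  have "eval_mpoly a (Poly_Mapping.single 0 1 :: ('v, 'a) mpoly) = 1"
    unfolding eval_mpoly_single by (simp add: monomial_value_def)
  then show "eval_mpoly a (1 :: ('v, 'a) mpoly) = 1" by simp
qed (simp_all add: eval_mpoly_add eval_mpoly_mult)

lemma to_fract_hom: "comm_ring_hom (to_fract :: 'b::idom \<Rightarrow> 'b fract)"
  by unfold_locales simp_all

section \<open>Minors, ranks and evaluation\<close>

lemma subm_map_mat:
  assumes "C \<in> carrier_mat m c" "\<rho> ` {..<k} \<subseteq> {..<m}" "\<gamma> ` {..<k} \<subseteq> {..<c}"
  shows "subm k \<rho> \<gamma> (map_mat h C) = map_mat h (subm k \<rho> \<gamma> C)"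
  using assms by (intro eq_matI) (auto simp: image_subset_iff)

lemma eval_minor:
  fixes C :: "('v, 'a::comm_ring_1) mpoly mat"
  assumes "C \<in> carrier_mat m c" "\<rho> ` {..<k} \<subseteq> {..<m}" "\<gamma> ` {..<k} \<subseteq> {..<c}"
  shows "eval_mpoly a (det (subm k \<rho> \<gamma> C)) = det (subm k \<rho> \<gamma> (eval_mat a C))"
  unfolding eval_mat_def subm_map_mat[OF assms]
  by (rule comm_ring_hom.hom_det[OF eval_mpoly_hom, symmetric])

lemma eval_mat_carrier: "C \<in> carrier_mat m c \<Longrightarrow> eval_mat a C \<in> carrier_mat m c"
  by (simp add: eval_mat_def)

text \<open>A minor that is nonzero at the point \<open>a\<close> is a nonzero polynomial, hence
  nonzero in the fraction field.\<close>

lemma rank_eval_le_generic_rank: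
  fixes C :: "('v::linorder, 'a::field) mpoly mat"
  assumes C: "C \<in> carrier_mat m c"
  shows "vec_space.rank m (eval_mat a C) \<le> generic_rank C"
proof -
  let ?k = "vec_space.rank m (eval_mat a C)"
  obtain \<rho> \<gamma> where \<rho>: "\<rho> ` {..<?k} \<subseteq> {..<m}" and \<gamma>: "\<gamma> ` {..<?k} \<subseteq> {..<c}"
    and d: "det (subm ?k \<rho> \<gamma> (eval_mat a C)) \<noteq> 0"
    by (rule rank_minor[OF eval_mat_carrier[OF C]])
  have "eval_mpoly a (det (subm ?k \<rho> \<gamma> C)) \<noteq> 0"
    unfolding eval_minor[OF C \<rho> \<gamma>] by (rule d)
  then have "det (subm ?k \<rho> \<gamma> C) \<noteq> 0" by auto
  then have "det (subm ?k \<rho> \<gamma> (map_mat to_fract C)) \<noteq> 0"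
    unfolding subm_map_mat[OF C \<rho> \<gamma>] comm_ring_hom.hom_det[OF to_fract_hom] by simp
  then have "?k \<le> vec_space.rank m (map_mat to_fract C)"
    by (intro minor_le_rank[OF _ \<rho> \<gamma>]) (use C in auto)
  then show ?thesis using C by (simp add: generic_rank_def)
qed

lemma generic_rank_matching:
  fixes C :: "('v::linorder, 'a::field) mpoly mat"
  assumes C: "C \<in> carrier_mat m c"
  obtains N where "matching N" "N \<subseteq> support C" "card N = generic_rank C"
proof -
  obtain N where N: "matching N" "N \<subseteq> support (map_mat to_fract C)" "card N = vec_space.rank m (map_mat to_fract C)"
    using rank_matching[of "map_mat to_fract C" m c] C by auto
  \<comment> \<open>The embedding into the fraction field is injective.\<close>
  have "support (map_mat to_fract C) = support C"
    by (auto simp: support_def)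
  then show ?thesis using that N C by (simp add: generic_rank_def)
qed

text \<open>Each unknown has exactly one position, so it can be set to 1 or 0 according to whether
  that position lies in \<open>W\<close>, independently of the others. Positions without an unknown
  are zero and lie outside \<open>W\<close>.\<close>

lemma matrix_of_unknowns_indicator:
  fixes C :: "('v, 'a::comm_semiring_1) mpoly mat"
  assumes unk: "matrix_of_unknowns C" and W: "W \<subseteq> support C"
  obtains a where "eval_mat a C = indicator_mat (dim_row C) (dim_col C) W"
proof -
  define occ where "occ l e \<longleftrightarrow> fst e < dim_row C \<and> snd e < dim_col C \<and> C $$ e = unknown l" for l e
  have ex1: "\<exists>!e. occ l e" for l
    using unk unfolding matrix_of_unknowns_def occ_def by (simp add: case_prod_unfold)
  define a :: "'v \<Rightarrow> 'a" where "a l = (if (THE e. occ l e) \<in> W then 1 else 0)" for l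
  have "eval_mat a C = indicator_mat (dim_row C) (dim_col C) W"
  proof (rule eq_matI)
    fix i j assume "i < dim_row (indicator_mat (dim_row C) (dim_col C) W :: 'a mat)"
      "j < dim_col (indicator_mat (dim_row C) (dim_col C) W :: 'a mat)"
    then have ij: "i < dim_row C" "j < dim_col C" by (auto simp: indicator_mat_def)
    have "eval_mpoly a (C $$ (i, j)) = (if (i, j) \<in> W then 1 else 0)"
    proof (cases "C $$ (i, j) \<in> range unknown")
      case True
      then obtain l where l: "C $$ (i, j) = unknown l" by auto
      then have "occ l (i, j)" using ij by (simp add: occ_def)
      then have "(THE e. occ l e) = (i, j)" using ex1[of l] by (rule the1_equality[rotated])
      then show ?thesis by (simp add: l eval_mpoly_unknown a_def)
    next
      case False
      then have "C $$ (i, j) = 0" using unk ij by (simp add: matrix_of_unknowns_def)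
      moreover from this have "(i, j) \<notin> W" using W by (auto simp: support_def)
      ultimately show ?thesis by simp
    qed
    then show "eval_mat a C $$ (i, j) = indicator_mat (dim_row C) (dim_col C) W $$ (i, j)"
      using ij by (simp add: eval_mat_def indicator_mat_def)
  qed (auto simp: eval_mat_def indicator_mat_def)
  then show ?thesis by (rule that)
qed

subsection \<open>Pairs of matchings and the canonical form\<close>

lemma matching_le_rank:
  assumes "matching N" "N \<subseteq> W" "inj_on snd W" "N \<subseteq> {..<m} \<times> {..<c}"
  shows "card N \<le> vec_space.rank m (indicator_mat m c W :: 'a::field mat)"
proof -
  obtain \<rho> \<gamma> where e: "bij_betw (\<lambda>i. (\<rho> i, \<gamma> i)) {..<card N} N"
    using matching_enum[OF assms(1)] .
  have "(\<rho> i, \<gamma> i) \<in> {..<m} \<times> {..<c}" if "i < card N" for i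
    using e that assms(4) by (auto simp: bij_betw_def)
  then have "\<rho> ` {..<card N} \<subseteq> {..<m}" "\<gamma> ` {..<card N} \<subseteq> {..<c}" by auto
  moreover have "det (subm (card N) \<rho> \<gamma> (indicator_mat m c W :: 'a mat)) \<noteq> 0"
    using matching_minor[OF e assms(2-4), where 'a='a] assms(1) by (simp add: matching_def)
  ultimately show ?thesis by (rule minor_le_rank[OF indicator_mat_carrier])
qed

lemma rank_indicator_matching:
  assumes "matching N" "N \<subseteq> {..<m} \<times> {..<c}"
  shows "vec_space.rank m (indicator_mat m c N :: 'a::field mat) = card N"
proof (rule antisym)
  have "support (indicator_mat m c N :: 'a mat) = N"
    using assms(2) by (auto simp: support_def indicator_mat_def split: if_splits)
  then have "vec_space.rank m (indicator_mat m c N :: 'a mat) \<le> card (fst ` N)"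
    using assms(1) by (intro rank_le_rows[OF indicator_mat_carrier]) (auto simp: matching_def)
  then show "vec_space.rank m (indicator_mat m c N :: 'a mat) \<le> card N"
    using assms(1) by (simp add: matching_def card_image)
  show "card N \<le> vec_space.rank m (indicator_mat m c N :: 'a mat)"
    using assms by (intro matching_le_rank) (auto simp: matching_def)
qed

section \<open>Joining matchings of the two blocks\<close>

definition shift_cols :: "nat \<Rightarrow> (nat \<times> nat) set \<Rightarrow> (nat \<times> nat) set" where
  "shift_cols p N = (\<lambda>(i, j). (i, p + j)) ` N"

lemma in_shift_cols [simp]: "(i, j) \<in> shift_cols p N \<longleftrightarrow> p \<le> j \<and> (i, j - p) \<in> N"
  by (force simp: shift_cols_def)

lemma fst_shift_cols [simp]: "fst ` shift_cols p N = fst ` N"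
  by (force simp: shift_cols_def)

lemma inj_on_snd_shift_cols: "inj_on snd N \<Longrightarrow> inj_on snd (shift_cols p N)"
  by (force simp: shift_cols_def inj_on_def)

lemma bip_join_indicator:
  assumes "W \<subseteq> {..<m} \<times> {..<p}"
  shows "bip_join (indicator_mat m p W) (indicator_mat m q Z) = indicator_mat m (p + q) (W \<union> shift_cols p Z)"
proof (rule eq_matI)
  have c: "bip_join (indicator_mat m p W) (indicator_mat m q Z) \<in> carrier_mat m (p + q)"
    by (intro bip_join_carrier) auto
  fix i j assume "i < dim_row (indicator_mat m (p + q) (W \<union> shift_cols p Z))"
    "j < dim_col (indicator_mat m (p + q) (W \<union> shift_cols p Z))"
  then have ij: "i < m" "j < p + q" by (auto simp: indicator_mat_def)
  show "bip_join (indicator_mat m p W) (indicator_mat m q Z) $$ (i, j)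
    = indicator_mat m (p + q) (W \<union> shift_cols p Z) $$ (i, j)"
    unfolding bip_join_index[OF indicator_mat_carrier indicator_mat_carrier ij]
    using ij assms by (auto simp: indicator_mat_def)
qed (auto simp: indicator_mat_def bip_join_def)

text \<open>The union of the two matchings would use twice each row covered on both sides. Dropping
  the edge of \<open>NB\<close> in such rows restores a matching and leaves the set of covered rows
  unchanged.\<close>

definition join_matching :: "nat \<Rightarrow> (nat \<times> nat) set \<Rightarrow> (nat \<times> nat) set \<Rightarrow> (nat \<times> nat) set" where
  "join_matching p NA NB = NA \<union> shift_cols p {e \<in> NB. fst e \<notin> fst ` NA}"

text \<open>The union itself may repeat rows but never columns, since the blocks occupy disjoint
  columns. This is the situation of \<open>matching_minor\<close>: a matching inside a larger set on
  which \<open>snd\<close> is injective.\<close>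

lemma join_matching:
  assumes NA: "matching NA" "NA \<subseteq> {..<m} \<times> {..<p}" and NB: "matching NB" "NB \<subseteq> {..<m} \<times> {..<q}"
  shows "matching (join_matching p NA NB)" "fst ` join_matching p NA NB = fst ` NA \<union> fst ` NB"
    "join_matching p NA NB \<subseteq> NA \<union> shift_cols p NB" "inj_on snd (NA \<union> shift_cols p NB)"
    "join_matching p NA NB \<subseteq> {..<m} \<times> {..<p + q}"
proof -
  let ?B = "{e \<in> NB. fst e \<notin> fst ` NA}"
  show rows: "fst ` join_matching p NA NB = fst ` NA \<union> fst ` NB"
    unfolding join_matching_def image_Un fst_shift_cols by auto
  have disj: "snd ` NA \<inter> snd ` shift_cols p NB = {}"
    using NA(2) by (auto simp: shift_cols_def)
  show inj: "inj_on snd (NA \<union> shift_cols p NB)"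
    using NA NB inj_on_snd_shift_cols[of NB p] disj unfolding inj_on_Un matching_def by blast
  show sub: "join_matching p NA NB \<subseteq> NA \<union> shift_cols p NB"
    by (auto simp: join_matching_def shift_cols_def)
  have "inj_on fst ?B" using NB(1) by (auto simp: matching_def intro: inj_on_subset)
  then have "inj_on fst (shift_cols p ?B)"
    by (auto simp: shift_cols_def inj_on_def)
  moreover have "fst ` NA \<inter> fst ` shift_cols p ?B = {}" unfolding fst_shift_cols by force
  ultimately have "inj_on fst (join_matching p NA NB)"
    using NA(1) unfolding join_matching_def inj_on_Un matching_def by blast
  moreover have "finite (join_matching p NA NB)"
    using NA(1) NB(1) by (auto simp: join_matching_def shift_cols_def matching_def)
  ultimately show "matching (join_matching p NA NB)"
    using inj_on_subset[OF inj sub] by (simp add: matching_def)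
  show "join_matching p NA NB \<subseteq> {..<m} \<times> {..<p + q}"
    using NA(2) NB(2) by (force simp: join_matching_def shift_cols_def)
qed

lemma card_join_matching:
  assumes NA: "matching NA" "NA \<subseteq> {..<m} \<times> {..<p}" and NB: "matching NB" "NB \<subseteq> {..<m} \<times> {..<q}"
  shows "card (join_matching p NA NB) = card (fst ` NA \<union> fst ` NB)"
  using join_matching(1,2)[OF assms] by (metis card_image matching_def)

text \<open>The covered rows are the only nonzero ones, which bounds the rank from above; the minor
  on \<open>join_matching\<close> attains the bound.\<close>

lemma rank_join_indicator:
  assumes NA: "matching NA" "NA \<subseteq> {..<m} \<times> {..<p}" and NB: "matching NB" "NB \<subseteq> {..<m} \<times> {..<q}"
  shows "vec_space.rank m (bip_join (indicator_mat m p NA) (indicator_mat m q NB) :: 'a::field mat)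
    = card (fst ` NA \<union> fst ` NB)"
proof (rule antisym)
  let ?W = "NA \<union> shift_cols p NB" and ?U = "fst ` NA \<union> fst ` NB"
  have "fst ` support (indicator_mat m (p + q) ?W :: 'a mat) \<subseteq> fst ` ?W"
    by (intro image_mono) (auto simp: support_def indicator_mat_def split: if_splits)
  then have s: "fst ` support (indicator_mat m (p + q) ?W :: 'a mat) \<subseteq> ?U"
    unfolding image_Un fst_shift_cols .
  show "vec_space.rank m (bip_join (indicator_mat m p NA) (indicator_mat m q NB) :: 'a mat) \<le> card ?U"
    unfolding bip_join_indicator[OF NA(2)]
    by (rule rank_le_rows[OF indicator_mat_carrier _ s]) (use NA NB in \<open>auto simp: matching_def\<close>)
  show "card ?U \<le> vec_space.rank m (bip_join (indicator_mat m p NA) (indicator_mat m q NB) :: 'a mat)"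
    unfolding bip_join_indicator[OF NA(2)] card_join_matching[OF assms, symmetric]
    by (intro matching_le_rank join_matching[OF assms])
qed

text \<open>Both canonical blocks are indicator matrices of matchings, so the three ranks reduce to
  counting edges and covered rows.\<close>

lemma canonical_ranks:
  assumes m: "r + s + t \<le> m" and p: "r + s \<le> p" and q: "r + t \<le> q"
  shows "vec_space.rank m (canon_left m p r s :: 'a::field mat) = r + s"
    "vec_space.rank m (canon_right m q r s t :: 'a mat) = r + t"
    "vec_space.rank m (bip_join (canon_left m p r s) (canon_right m q r s t) :: 'a mat) = r + s + t"
proof -
  let ?NA = "(\<lambda>j. (j, j)) ` {..<r + s}"
  \<comment> \<open>The row of the one in column \<open>j\<close> of the right block: the first
    \<open>t\<close> columns carry \<open>I_t\<close> in the third strip, the next \<open>r\<close>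
    columns carry \<open>I_r\<close> in the first.\<close>
  let ?f = "\<lambda>j. if j < t then r + s + j else j - t"
  let ?NB = "(\<lambda>j. (?f j, j)) ` {..<t + r}"
  have L: "canon_left m p r s = (indicator_mat m p ?NA :: 'a mat)"
    by (intro eq_matI) (auto simp: canon_left_def indicator_mat_def)
  have mem: "(i, j) \<in> ?NB \<longleftrightarrow> j < t + r \<and> i = ?f j" for i j by auto
  have R: "canon_right m q r s t = (indicator_mat m q ?NB :: 'a mat)"
    by (intro eq_matI) (auto simp: canon_right_def indicator_mat_def mem simp del: image_iff split: if_splits)
  have NA: "matching ?NA" "?NA \<subseteq> {..<m} \<times> {..<p}"
    using m p by (auto simp: matching_def inj_on_def)
  have NB: "matching ?NB" "?NB \<subseteq> {..<m} \<times> {..<q}"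
    using m q by (auto simp: matching_def inj_on_def split: if_splits)
  have cA: "card ?NA = r + s" by (subst card_image) (auto simp: inj_on_def)
  have cB: "card ?NB = r + t" by (subst card_image) (auto simp: inj_on_def)
  show "vec_space.rank m (canon_left m p r s :: 'a mat) = r + s"
    unfolding L rank_indicator_matching[OF NA] by (rule cA)
  show "vec_space.rank m (canon_right m q r s t :: 'a mat) = r + t"
    unfolding R rank_indicator_matching[OF NB] by (rule cB)
  have fA: "fst ` ?NA = {..<r + s}" by force
  have fB: "fst ` ?NB = {..<r} \<union> {r + s..<r + s + t}"
  proof (intro equalityI subsetI)
    fix i assume "i \<in> {..<r} \<union> {r + s..<r + s + t}"
    \<comment> \<open>The conditional expression inverts \<open>?f\<close> on the two row
      strips.\<close>
    then have "i = ?f (if i < r then i + t else i - (r + s))" "(if i < r then i + t else i - (r + s)) < t + r"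
      by auto
    then have "(i, if i < r then i + t else i - (r + s)) \<in> ?NB" unfolding mem by blast
    then show "i \<in> fst ` ?NB" by (rule image_eqI[rotated]) simp
  qed auto
  have U: "fst ` ?NA \<union> fst ` ?NB = {..<r + s + t}"
    unfolding fA fB by auto
  show "vec_space.rank m (bip_join (canon_left m p r s) (canon_right m q r s t) :: 'a mat) = r + s + t"
    unfolding L R rank_join_indicator[OF NA NB] U by simp
qed

lemma canonical_form_reduces:
  fixes A B :: "'a::field mat"
  assumes "has_canonical_form m p q r s t (A, B)"
  shows "bip_reduces m p q (canon_left m p r s, canon_right m q r s t) (A, B)"
proof -
  from assms obtain \<sigma> \<pi> \<rho> where *: "\<sigma> permutes {..<m}" "\<pi> permutes {..<p}" "\<rho> permutes {..<q}"
    "A = permute_mat \<sigma> \<pi> (canon_left m p r s)" "B = permute_mat \<sigma> \<rho> (canon_right m q r s t)"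
    by (auto simp: has_canonical_form_def)
  obtain P Q1 :: "'a mat" where P: "P = permute_mat \<sigma> id (1\<^sub>m m)" "P \<in> carrier_mat m m" "Q1 \<in> carrier_mat p p"
    "invertible_mat P" "invertible_mat Q1" and 1: "\<And>C. C \<in> carrier_mat m p \<Longrightarrow> P * C * Q1 = permute_mat \<sigma> \<pi> C"
    by (rule permute_mat_factors[OF *(1,2)], rule that)
  obtain P' Q2 :: "'a mat" where P': "P' = permute_mat \<sigma> id (1\<^sub>m m)" "P' \<in> carrier_mat m m" "Q2 \<in> carrier_mat q q"
    "invertible_mat P'" "invertible_mat Q2" and 2: "\<And>C. C \<in> carrier_mat m q \<Longrightarrow> P' * C * Q2 = permute_mat \<sigma> \<rho> C"
    by (rule permute_mat_factors[OF *(1,3)], rule that)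
  have "P' = P" using P(1) P'(1) by simp
  show ?thesis
    unfolding *(4,5) 1[OF canon_carrier(1), symmetric] 2[OF canon_carrier(2), symmetric] \<open>P' = P\<close>
    by (rule bip_reducesI[OF P(2,3) P'(3) P(4,5) P'(5) refl refl])
qed

lemma canonical_form_ranks:
  fixes A B :: "'a::field mat"
  assumes "has_canonical_form m p q r s t (A, B)"
  shows "r + s = vec_space.rank m A" "r + t = vec_space.rank m B" "r + s + t = vec_space.rank m (bip_join A B)"
proof -
  have fits: "r + s + t \<le> m" "r + s \<le> p" "r + t \<le> q"
    using assms by (auto simp: has_canonical_form_def)
  show "r + s = vec_space.rank m A" "r + t = vec_space.rank m B" "r + s + t = vec_space.rank m (bip_join A B)"
    using bip_reduces_rank[OF canonical_form_reduces[OF assms] canon_carrier] canonical_ranks[OF fits, where 'a='a]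
    by simp_all
qed

text \<open>Once the rows have labels \<open>\<kappa>\<close>, each matched column is sent to the
  label of its partner, and the other columns fill the remaining places. As the permutation is
  injective, no unmatched column can receive a label of a matched row, which gives the converse
  implication.\<close>

lemma matching_column_permutation:
  assumes N: "matching N" "snd ` N \<subseteq> {..<c}" and \<kappa>: "inj_on \<kappa> (fst ` N)" "\<kappa> ` fst ` N \<subseteq> {..<c::nat}"
  obtains \<pi> where "\<pi> permutes {..<c}" "\<And>i j. (i, j) \<in> N \<longleftrightarrow> i \<in> fst ` N \<and> \<pi> j = \<kappa> i"
proof -
  define h where "h j = \<kappa> (THE i. (i, j) \<in> N)" for j
  have h: "h j = \<kappa> i" if "(i, j) \<in> N" for i j
  proof -
    have "(THE i. (i, j) \<in> N) = i"
      using that by (rule the_equality) (rule matching_colD[OF N(1) _ that])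
    then show ?thesis by (simp add: h_def)
  qed
  have h_inj: "inj_on h (snd ` N)"
  proof (rule inj_onI)
    fix j j' assume "j \<in> snd ` N" "j' \<in> snd ` N" and eq: "h j = h j'"
    then obtain i i' where ij: "(i, j) \<in> N" "(i', j') \<in> N" by force
    have "i = i'"
      using inj_onD[OF \<kappa>(1), of i i'] eq h[OF ij(1)] h[OF ij(2)] ij by force
    then show "j = j'" using matching_rowD[OF N(1) ij(1), of j'] ij(2) by simp
  qed
  have h_sub: "h ` snd ` N \<subseteq> {..<c}" using h \<kappa>(2) by force
  obtain \<pi> where \<pi>: "\<pi> permutes {..<c}" and eq: "\<And>j. j \<in> snd ` N \<Longrightarrow> \<pi> j = h j"
    by (rule extend_to_permutation[OF finite_lessThan N(2) h_sub h_inj], rule that)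
  have *: "\<pi> j = \<kappa> i" if "(i, j) \<in> N" for i j
    using eq[of j] h[OF that] that by force
  show ?thesis
  proof (rule that[OF \<pi>], rule iffI)
    fix i j assume "(i, j) \<in> N"
    then show "i \<in> fst ` N \<and> \<pi> j = \<kappa> i" using * by force
  next
    fix i j assume a: "i \<in> fst ` N \<and> \<pi> j = \<kappa> i"
    then obtain j' where j': "(i, j') \<in> N" by force
    then have "\<pi> j' = \<pi> j" using * a by simp
    then have "j' = j" using permutes_inj[OF \<pi>] by (simp add: inj_eq)
    then show "(i, j) \<in> N" using j' by simp
  qed
qed

lemma bij_onto_interval:
  assumes "finite X" "card X = b - a"
  shows "\<exists>h. bij_betw h X {a..<b::nat}"
  using assms finite_same_card_bij[of X "{a..<b}"] by auto

text \<open>Only the row permutation is shared by the blocks. It sorts the rows into those covered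
  on both sides, by \<open>NA\<close> only, by \<open>NB\<close> only, and by neither; the columns
  of each block can then be arranged separately along its own matching.\<close>

lemma matchings_canonical_form:
  assumes NA: "matching NA" "NA \<subseteq> {..<m} \<times> {..<p}" and NB: "matching NB" "NB \<subseteq> {..<m} \<times> {..<q}"
  defines "r \<equiv> card (fst ` NA \<inter> fst ` NB)" and "s \<equiv> card (fst ` NA - fst ` NB)" and "t \<equiv> card (fst ` NB - fst ` NA)"
  shows "has_canonical_form m p q r s t (indicator_mat m p NA, indicator_mat m q NB :: 'a::field mat)"
proof -
  let ?RA = "fst ` NA" and ?RB = "fst ` NB"
  have fin: "finite ?RA" "finite ?RB" using NA NB by (auto simp: matching_def)
  have sub: "?RA \<union> ?RB \<subseteq> {..<m}" using NA(2) NB(2) by auto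
  have cA: "r + s = card ?RA"
    unfolding r_def s_def using fin card_Un_disjoint[of "?RA \<inter> ?RB" "?RA - ?RB"] by (simp add: Int_Diff_Un Int_Diff_disjoint)
  have cB: "r + t = card ?RB"
    unfolding r_def t_def
    by (subst card_Un_disjoint[symmetric]) (use fin in \<open>auto intro!: arg_cong[where f = card]\<close>)
  have "card (?RA \<union> ?RB) = r + s + t"
    using fin card_Un_disjoint[of ?RA "?RB - ?RA"] cA by (simp add: t_def)
  then have m: "r + s + t \<le> m" using card_mono[OF _ sub] by simp
  have "card NA = r + s" "card NB = r + t"
    unfolding cA cB using NA(1) NB(1) by (simp_all add: matching_def card_image)
  moreover have "snd ` NA \<subseteq> {..<p}" "snd ` NB \<subseteq> {..<q}" using NA(2) NB(2) by auto
  then have "card (snd ` NA) \<le> p" "card (snd ` NB) \<le> q"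
    using card_mono[of "{..<p}" "snd ` NA"] card_mono[of "{..<q}" "snd ` NB"] by simp_all
  ultimately have p: "r + s \<le> p" and q: "r + t \<le> q"
    using NA(1) NB(1) by (simp_all add: matching_def card_image)
  have cards: "card (?RA \<inter> ?RB) = r - 0" "card (?RA - ?RB) = r + s - r" "card (?RB - ?RA) = r + s + t - (r + s)"
    by (simp_all add: r_def s_def t_def)
  have fins: "finite (?RA \<inter> ?RB)" "finite (?RA - ?RB)" "finite (?RB - ?RA)" using fin by simp_all
  obtain h1 where h1: "bij_betw h1 (?RA \<inter> ?RB) {0..<r}"
    using bij_onto_interval[OF fins(1) cards(1)] by (rule exE)
  obtain h2 where h2: "bij_betw h2 (?RA - ?RB) {r..<r + s}"
    using bij_onto_interval[OF fins(2) cards(2)] by (rule exE)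
  obtain h3 where h3: "bij_betw h3 (?RB - ?RA) {r + s..<r + s + t}"
    using bij_onto_interval[OF fins(3) cards(3)] by (rule exE)
  define f where "f x = (if x \<in> ?RA \<inter> ?RB then h1 x else if x \<in> ?RA then h2 x else h3 x)" for x
  have f1: "bij_betw f (?RA \<inter> ?RB) {0..<r}"
    using h1 by (rule bij_betw_cong[THEN iffD1, rotated]) (simp add: f_def)
  have f2: "bij_betw f (?RA - ?RB) {r..<r + s}"
    using h2 by (rule bij_betw_cong[THEN iffD1, rotated]) (simp add: f_def)
  have f3: "bij_betw f (?RB - ?RA) {r + s..<r + s + t}"
    using h3 by (rule bij_betw_cong[THEN iffD1, rotated]) (simp add: f_def)
  have fA: "bij_betw f ?RA {0..<r + s}"
    using bij_betw_combine[OF f1 f2] by (simp add: Int_Diff_Un ivl_disj_un ivl_disj_int)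
  have fU: "bij_betw f (?RA \<union> ?RB) {0..<r + s + t}"
    using bij_betw_combine[OF fA f3] by (simp add: ivl_disj_un ivl_disj_int)
  obtain \<sigma> where \<sigma>: "\<sigma> permutes {..<m}" "\<And>x. x \<in> ?RA \<union> ?RB \<Longrightarrow> \<sigma> x = f x"
  proof (rule extend_to_permutation[OF finite_lessThan sub])
    show "f ` (?RA \<union> ?RB) \<subseteq> {..<m}" "inj_on f (?RA \<union> ?RB)"
      using fU m by (auto simp: bij_betw_def)
  qed (rule that)
  \<comment> \<open>The images of the row classes are intervals, so membership in a class becomes an
    inequality for \<open>\<sigma> x\<close>, and the comparison of entries becomes
    arithmetic.\<close>
  have s1: "\<sigma> ` (?RA \<inter> ?RB) = {0..<r}" using f1 \<sigma>(2) by (auto simp: bij_betw_def image_def)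
  have s2: "\<sigma> ` ?RA = {0..<r + s}" using fA \<sigma>(2) by (auto simp: bij_betw_def image_def)
  have s3: "\<sigma> ` (?RB - ?RA) = {r + s..<r + s + t}" using f3 \<sigma>(2) by (auto simp: bij_betw_def image_def)
  have mem: "\<sigma> x \<in> \<sigma> ` X \<longleftrightarrow> x \<in> X" for x X
    using permutes_inj[OF \<sigma>(1)] by (rule inj_image_mem_iff)
  have iA: "x \<in> ?RA \<longleftrightarrow> \<sigma> x < r + s" for x
    using mem[of x ?RA] unfolding s2 by simp
  have iAB: "x \<in> ?RA \<and> x \<in> ?RB \<longleftrightarrow> \<sigma> x < r" for x
    using mem[of x "?RA \<inter> ?RB"] unfolding s1 by simp
  have iBA: "x \<in> ?RB \<and> x \<notin> ?RA \<longleftrightarrow> r + s \<le> \<sigma> x \<and> \<sigma> x < r + s + t" for x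
    using mem[of x "?RB - ?RA"] unfolding s3 by simp
  have iB: "x \<in> ?RB \<longleftrightarrow> \<sigma> x < r \<or> r + s \<le> \<sigma> x \<and> \<sigma> x < r + s + t" for x
    using iAB[of x] iBA[of x] by blast
  have inj: "\<sigma> x = \<sigma> y \<longleftrightarrow> x = y" for x y using permutes_inj[OF \<sigma>(1)] by (rule inj_eq)
  obtain \<pi> where \<pi>: "\<pi> permutes {..<p}" "\<And>i j. (i, j) \<in> NA \<longleftrightarrow> i \<in> ?RA \<and> \<pi> j = \<sigma> i"
  proof (rule matching_column_permutation[OF NA(1)])
    show "snd ` NA \<subseteq> {..<p}" using NA(2) by auto
    show "inj_on \<sigma> ?RA" using inj by (simp add: inj_on_def)
    show "\<sigma> ` ?RA \<subseteq> {..<p}" unfolding s2 using p by auto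
  qed (rule that)
  \<comment> \<open>The column of the one that \<open>canon_right\<close> has in row
    \<open>\<sigma> i\<close>, for rows of the first and the third strip. For the left block this
    column is \<open>\<sigma> i\<close> itself.\<close>
  define \<kappa> where "\<kappa> i = (if \<sigma> i < r then t + \<sigma> i else \<sigma> i - (r + s))" for i
  obtain \<rho> where \<rho>: "\<rho> permutes {..<q}" "\<And>i j. (i, j) \<in> NB \<longleftrightarrow> i \<in> ?RB \<and> \<rho> j = \<kappa> i"
  proof (rule matching_column_permutation[OF NB(1)])
    show "snd ` NB \<subseteq> {..<q}" using NB(2) by auto
    show "inj_on \<kappa> ?RB"
    proof (rule inj_onI)
      fix x y assume "x \<in> ?RB" "y \<in> ?RB" "\<kappa> x = \<kappa> y"
      then have "\<sigma> x = \<sigma> y" unfolding iB \<kappa>_def by (auto split: if_splits)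
      then show "x = y" using inj by simp
    qed
    show "\<kappa> ` ?RB \<subseteq> {..<q}"
    proof
      fix y assume "y \<in> \<kappa> ` ?RB"
      then obtain x where "x \<in> ?RB" "y = \<kappa> x" by (rule imageE)
      then show "y \<in> {..<q}" unfolding iB \<kappa>_def using q by (auto split: if_splits)
    qed
  qed (rule that)
  have "indicator_mat m p NA = (permute_mat \<sigma> \<pi> (canon_left m p r s) :: 'a mat)"
  proof (rule eq_matI)
    fix i j assume "i < dim_row (permute_mat \<sigma> \<pi> (canon_left m p r s) :: 'a mat)"
      "j < dim_col (permute_mat \<sigma> \<pi> (canon_left m p r s) :: 'a mat)"
    then have ij: "i < m" "j < p" by (auto simp: permute_mat_def canon_left_def)
    have "(i, j) \<in> NA \<longleftrightarrow> \<sigma> i = \<pi> j \<and> \<pi> j < r + s" unfolding \<pi>(2) iA by auto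
    then show "indicator_mat m p NA $$ (i, j) = (permute_mat \<sigma> \<pi> (canon_left m p r s) :: 'a mat) $$ (i, j)"
      using ij permutes_less[OF \<sigma>(1) ij(1)] permutes_less[OF \<pi>(1) ij(2)]
      by (simp add: indicator_mat_def permute_mat_def canon_left_def)
  qed (auto simp: indicator_mat_def permute_mat_def canon_left_def)
  moreover have "indicator_mat m q NB = (permute_mat \<sigma> \<rho> (canon_right m q r s t) :: 'a mat)"
  proof (rule eq_matI)
    fix i j assume "i < dim_row (permute_mat \<sigma> \<rho> (canon_right m q r s t) :: 'a mat)"
      "j < dim_col (permute_mat \<sigma> \<rho> (canon_right m q r s t) :: 'a mat)"
    then have ij: "i < m" "j < q" by (auto simp: permute_mat_def canon_right_def)
    have "(i, j) \<in> NB \<longleftrightarrow> \<rho> j < t \<and> \<sigma> i = r + s + \<rho> j \<or> t \<le> \<rho> j \<and> \<rho> j < t + r \<and> \<sigma> i = \<rho> j - t"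
      unfolding \<rho>(2) iB \<kappa>_def by auto
    then show "indicator_mat m q NB $$ (i, j) = (permute_mat \<sigma> \<rho> (canon_right m q r s t) :: 'a mat) $$ (i, j)"
      using ij permutes_less[OF \<sigma>(1) ij(1)] permutes_less[OF \<rho>(1) ij(2)]
      by (simp add: indicator_mat_def permute_mat_def canon_right_def)
  qed (auto simp: indicator_mat_def permute_mat_def canon_right_def)
  ultimately show ?thesis
    unfolding has_canonical_form_def using m p q \<sigma>(1) \<pi>(1) \<rho>(1) by blast
qed

subsection \<open>Generic matrices\<close>

lemma eval_mat_bip_join:
  fixes A B :: "('v, 'a::comm_semiring_1) mpoly mat"
  assumes "A \<in> carrier_mat m p" "B \<in> carrier_mat m q"
  shows "eval_mat a (bip_join A B) = bip_join (eval_mat a A) (eval_mat a B)"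
  using assms by (intro eq_matI) (auto simp: eval_mat_def bip_join_def)

lemma support_carrier: "C \<in> carrier_mat m c \<Longrightarrow> support C \<subseteq> {..<m} \<times> {..<c}"
  by (auto simp: support_def)

lemma support_bip_join:
  assumes "A \<in> carrier_mat m p" "B \<in> carrier_mat m q"
  shows "(i, j) \<in> support (bip_join A B) \<longleftrightarrow>
    (if j < p then (i, j) \<in> support A else (i, j - p) \<in> support B)"
  using assms bip_join_carrier[OF assms] bip_join_index[OF assms]
  by (auto simp: support_def)

text \<open>One point serves both blocks, because the unknowns are distinct across the whole joined
  matrix: the prescribed positions are united there and the result is read off block by
  block.\<close>

lemma bip_indicator:
  fixes A B :: "('v, 'a::comm_semiring_1) mpoly mat"
  assumes A: "A \<in> carrier_mat m p" and B: "B \<in> carrier_mat m q"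
    and unk: "matrix_of_unknowns (bip_join A B)" and W: "W \<subseteq> support A" and Z: "Z \<subseteq> support B"
  obtains a where "eval_mat a A = indicator_mat m p W" "eval_mat a B = indicator_mat m q Z"
    "eval_mat a (bip_join A B) = bip_join (indicator_mat m p W) (indicator_mat m q Z)"
proof -
  note M = bip_join_carrier[OF A B]
  have Wp: "W \<subseteq> {..<m} \<times> {..<p}" using W support_carrier[OF A] by blast
  have "W \<union> shift_cols p Z \<subseteq> support (bip_join A B)"
  proof
    fix e assume "e \<in> W \<union> shift_cols p Z"
    moreover obtain i j where e: "e = (i, j)" by (cases e)
    ultimately show "e \<in> support (bip_join A B)"
      using W Z Wp unfolding e support_bip_join[OF A B] by auto
  qed
  then obtain a where "eval_mat a (bip_join A B) = indicator_mat m (p + q) (W \<union> shift_cols p Z)"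
    using matrix_of_unknowns_indicator[OF unk] carrier_matD[OF M] by metis
  then have a: "eval_mat a (bip_join A B) = bip_join (indicator_mat m p W) (indicator_mat m q Z)"
    using bip_join_indicator[OF Wp] by metis
  then have eq: "bip_join (eval_mat a A) (eval_mat a B) = bip_join (indicator_mat m p W) (indicator_mat m q Z)"
    unfolding eval_mat_bip_join[OF A B] .
  have "eval_mat a A = indicator_mat m p W"
  proof (rule eq_matI)
    fix i j assume "i < dim_row (indicator_mat m p W :: 'a mat)" "j < dim_col (indicator_mat m p W :: 'a mat)"
    then have ij: "i < m" "j < p" by (auto simp: indicator_mat_def)
    show "eval_mat a A $$ (i, j) = indicator_mat m p W $$ (i, j)"
      using arg_cong[OF eq, of "\<lambda>M. M $$ (i, j)"] ij
      by (simp add: bip_join_index[OF eval_mat_carrier[OF A] eval_mat_carrier[OF B]]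
          bip_join_index[OF indicator_mat_carrier indicator_mat_carrier])
  qed (use A in \<open>auto simp: eval_mat_def indicator_mat_def\<close>)
  moreover have "eval_mat a B = indicator_mat m q Z"
  proof (rule eq_matI)
    fix i j assume "i < dim_row (indicator_mat m q Z :: 'a mat)" "j < dim_col (indicator_mat m q Z :: 'a mat)"
    then have ij: "i < m" "j < q" by (auto simp: indicator_mat_def)
    show "eval_mat a B $$ (i, j) = indicator_mat m q Z $$ (i, j)"
      using arg_cong[OF eq, of "\<lambda>M. M $$ (i, p + j)"] ij
      by (simp add: bip_join_index[OF eval_mat_carrier[OF A] eval_mat_carrier[OF B]]
          bip_join_index[OF indicator_mat_carrier indicator_mat_carrier])
  qed (use B in \<open>auto simp: eval_mat_def indicator_mat_def\<close>)
  ultimately show ?thesis using a by (rule that)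
qed

text \<open>
  A maximum matching of \<open>[A | B]\<close> splits into a matching of \<open>A\<close> and one of \<open>B\<close>. Extending each to a
  maximum matching of its block, without uncovering rows, covers as many rows as \<open>[A | B]\<close> allows.
\<close>

lemma generic_matchings:
  fixes A B :: "('v::linorder, 'a::field) mpoly mat"
  assumes A: "A \<in> carrier_mat m p" and B: "B \<in> carrier_mat m q" and unk: "matrix_of_unknowns (bip_join A B)"
  obtains NA NB where "matching NA" "NA \<subseteq> support A" "card NA = generic_rank A"
    "matching NB" "NB \<subseteq> support B" "card NB = generic_rank B"
    "card (fst ` NA \<union> fst ` NB) = generic_rank (bip_join A B)"
proof -
  note M = bip_join_carrier[OF A B]
  have ind: "\<exists>a. eval_mat a A = indicator_mat m p W \<and> eval_mat a B = indicator_mat m q Z \<and>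
      eval_mat a (bip_join A B) = bip_join (indicator_mat m p W) (indicator_mat m q Z)"
    if "W \<subseteq> support A" "Z \<subseteq> support B" for W Z
    by (rule bip_indicator[OF A B unk that]) blast
  obtain N where N: "matching N" "N \<subseteq> support (bip_join A B)" "card N = generic_rank (bip_join A B)"
    by (rule generic_rank_matching[OF M])
  define WA where "WA = {e \<in> N. snd e < p}"
  define WB where "WB = {(i, j). (i, p + j) \<in> N}"
  have WA: "matching WA" "WA \<subseteq> support A"
  proof -
    show "matching WA" using N(1) by (auto simp: matching_def WA_def intro: inj_on_subset)
    show "WA \<subseteq> support A" using N(2) support_bip_join[OF A B] by (fastforce simp: WA_def)
  qed
  have WB: "matching WB" "WB \<subseteq> support B"
  proof -
    show sub: "WB \<subseteq> support B"
    proof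
      fix e assume e: "e \<in> WB"
      obtain i j where ij: "e = (i, j)" by (cases e)
      then have "(i, p + j) \<in> support (bip_join A B)" using e N(2) by (auto simp: WB_def)
      then show "e \<in> support B" unfolding ij support_bip_join[OF A B] by simp
    qed
    have "inj_on fst WB"
    proof (rule inj_onI, clarify)
      fix i j i' j' assume "(i, j) \<in> WB" "(i', j') \<in> WB" "fst (i, j) = fst (i', j')"
      then show "i = i' \<and> j = j'" using matching_rowD[OF N(1), of i "p + j" "p + j'"] by (simp add: WB_def)
    qed
    moreover have "inj_on snd WB"
    proof (rule inj_onI, clarify)
      fix i j i' j' assume "(i, j) \<in> WB" "(i', j') \<in> WB" "snd (i, j) = snd (i', j')"
      then show "i = i' \<and> j = j'" using matching_colD[OF N(1), of i "p + j" i'] by (simp add: WB_def)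
    qed
    ultimately show "matching WB"
      using finite_subset[OF sub finite_support] by (simp add: matching_def)
  qed
  have rows: "fst ` N \<subseteq> fst ` WA \<union> fst ` WB"
  proof
    fix i assume "i \<in> fst ` N"
    then obtain j where j: "(i, j) \<in> N" by force
    show "i \<in> fst ` WA \<union> fst ` WB"
    proof (cases "j < p")
      case True
      then have "(i, j) \<in> WA" using j by (simp add: WA_def)
      then show ?thesis by force
    next
      case False
      then have "(i, j - p) \<in> WB" using j by (simp add: WB_def)
      then show ?thesis by force
    qed
  qed
  \<comment> \<open>Setting the unknowns on \<open>W\<close> to 1 and the others to 0 gives a matrix
    of rank \<open>card W\<close>, so no matching exceeds the generic rank. This supplies the
    comparison of sizes for \<open>matching_extend\<close>.\<close>
  have leA: "card W \<le> generic_rank A" if W: "matching W" "W \<subseteq> support A" for W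
  proof -
    obtain a where a: "eval_mat a A = indicator_mat m p W" using ind[OF W(2), of "{}"] by auto
    show ?thesis
      using rank_eval_le_generic_rank[OF A, of a] support_carrier[OF A] W
        rank_indicator_matching[OF W(1), of m p, where 'a='a] unfolding a by auto
  qed
  have leB: "card W \<le> generic_rank B" if W: "matching W" "W \<subseteq> support B" for W
  proof -
    obtain a where a: "eval_mat a B = indicator_mat m q W" using ind[OF _ W(2), of "{}"] by auto
    show ?thesis
      using rank_eval_le_generic_rank[OF B, of a] support_carrier[OF B] W
        rank_indicator_matching[OF W(1), of m q, where 'a='a] unfolding a by auto
  qed
  obtain NA' where NA': "matching NA'" "NA' \<subseteq> support A" "card NA' = generic_rank A"
    by (rule generic_rank_matching[OF A])
  obtain NB' where NB': "matching NB'" "NB' \<subseteq> support B" "card NB' = generic_rank B"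
    by (rule generic_rank_matching[OF B])
  have "card WA \<le> card NA'" "card WB \<le> card NB'"
    using leA[OF WA] leB[OF WB] NA'(3) NB'(3) by simp_all
  obtain NA where NA: "matching NA" "NA \<subseteq> WA \<union> NA'" "card NA = card NA'" "fst ` WA \<subseteq> fst ` NA"
    by (rule matching_extend[OF WA(1) NA'(1) \<open>card WA \<le> card NA'\<close>])
  obtain NB where NB: "matching NB" "NB \<subseteq> WB \<union> NB'" "card NB = card NB'" "fst ` WB \<subseteq> fst ` NB"
    by (rule matching_extend[OF WB(1) NB'(1) \<open>card WB \<le> card NB'\<close>])
  have subA: "NA \<subseteq> support A" using NA(2) WA(2) NA'(2) by blast
  have subB: "NB \<subseteq> support B" using NB(2) WB(2) NB'(2) by blast
  have boxA: "NA \<subseteq> {..<m} \<times> {..<p}" using subA support_carrier[OF A] by blast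
  have boxB: "NB \<subseteq> {..<m} \<times> {..<q}" using subB support_carrier[OF B] by blast
  have "card (fst ` NA \<union> fst ` NB) = generic_rank (bip_join A B)"
  proof (rule antisym)
    have "generic_rank (bip_join A B) = card (fst ` N)"
      using N(1,3) by (simp add: matching_def card_image)
    also have "\<dots> \<le> card (fst ` NA \<union> fst ` NB)"
    proof (rule card_mono)
      show "finite (fst ` NA \<union> fst ` NB)" using NA(1) NB(1) by (simp add: matching_def)
      show "fst ` N \<subseteq> fst ` NA \<union> fst ` NB" using rows NA(4) NB(4) by blast
    qed
    finally show "generic_rank (bip_join A B) \<le> card (fst ` NA \<union> fst ` NB)" .
    obtain a where "eval_mat a (bip_join A B) = bip_join (indicator_mat m p NA) (indicator_mat m q NB)"
      using ind[OF subA subB] by blast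
    then show "card (fst ` NA \<union> fst ` NB) \<le> generic_rank (bip_join A B)"
      using rank_eval_le_generic_rank[OF M, of a] rank_join_indicator[OF NA(1) boxA NB(1) boxB, where 'a='a] by simp
  qed
  then show ?thesis
    using that[OF NA(1) subA _ NB(1) subB] NA(3) NA'(3) NB(3) NB'(3) by simp
qed

text \<open>\<open>d\<close> is the minor enumerated along \<open>N\<close>. Where it does not
  vanish it bounds the rank from below, while the generic rank is an upper bound at every point. For
  the single blocks \<open>W\<close> is \<open>N\<close>; for the joined matrix \<open>W\<close> is
  the union of both matchings and \<open>N\<close> only part of it.\<close>

lemma generic_minor:
  fixes C :: "('v::linorder, 'a::field) mpoly mat"
  assumes C: "C \<in> carrier_mat m c" and a: "eval_mat a C = indicator_mat m c W"
    and N: "matching N" "N \<subseteq> W" "inj_on snd W" "N \<subseteq> {..<m} \<times> {..<c}" "card N = generic_rank C"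
  obtains d where "eval_mpoly a d = 1"
    "\<And>b. eval_mpoly b d \<noteq> 0 \<Longrightarrow> vec_space.rank m (eval_mat b C) = generic_rank C"
proof -
  obtain \<rho> \<gamma> where e: "bij_betw (\<lambda>i. (\<rho> i, \<gamma> i)) {..<card N} N"
    using matching_enum[OF N(1)] .
  have "(\<rho> i, \<gamma> i) \<in> {..<m} \<times> {..<c}" if "i < card N" for i
    using e that N(4) by (auto simp: bij_betw_def)
  then have \<rho>: "\<rho> ` {..<card N} \<subseteq> {..<m}" and \<gamma>: "\<gamma> ` {..<card N} \<subseteq> {..<c}" by auto
  let ?d = "det (subm (card N) \<rho> \<gamma> C)"
  show ?thesis
  proof (rule that)
    have "inj_on fst N" using N(1) by (simp add: matching_def)
    show "eval_mpoly a ?d = 1"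
      unfolding eval_minor[OF C \<rho> \<gamma>] a matching_minor[OF e N(2,3,4) \<open>inj_on fst N\<close>] by (rule det_one)
    fix b assume "eval_mpoly b ?d \<noteq> 0"
    then have "card N \<le> vec_space.rank m (eval_mat b C)"
      unfolding eval_minor[OF C \<rho> \<gamma>] by (rule minor_le_rank[OF eval_mat_carrier[OF C] \<rho> \<gamma>])
    then show "vec_space.rank m (eval_mat b C) = generic_rank C"
      using rank_eval_le_generic_rank[OF C, of b] N(5) by simp
  qed
qed

theorem theorem1:
  fixes A B :: "('v::{finite, linorder}, 'a::field) mpoly mat"
    and m p q :: nat
  assumes "A \<in> carrier_mat m p" and "B \<in> carrier_mat m q"
    and "matrix_of_unknowns (bip_join A B)"
  shows "\<exists>(f :: ('v, 'a) mpoly) Mgen.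
    f \<noteq> 0 \<and>
    Mgen \<in> bip_family A B f \<and>
    (\<forall>M \<in> bip_family A B f. bip_reduces m p q M Mgen) \<and>
    (\<exists>r s t.
       has_canonical_form m p q r s t Mgen \<and>
       r + s = generic_rank A \<and> r + t = generic_rank B \<and> r + s + t = generic_rank (bip_join A B) \<and>
       (\<forall>r' s' t'. has_canonical_form m p q r' s' t' Mgen \<longrightarrow> r' = r \<and> s' = s \<and> t' = t) \<and>
       (\<forall>r' s' t'. r' + s' = generic_rank A \<and> r' + t' = generic_rank B \<and>
          r' + s' + t' = generic_rank (bip_join A B) \<longrightarrow> r' = r \<and> s' = s \<and> t' = t))"
proof -
  note A = assms(1) and B = assms(2) and M = bip_join_carrier[OF assms(1,2)]
  obtain NA NB where NA: "matching NA" "NA \<subseteq> support A" "card NA = generic_rank A"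
    and NB: "matching NB" "NB \<subseteq> support B" "card NB = generic_rank B"
    and U: "card (fst ` NA \<union> fst ` NB) = generic_rank (bip_join A B)"
    by (rule generic_matchings[OF assms])
  have boxA: "NA \<subseteq> {..<m} \<times> {..<p}" using NA(2) support_carrier[OF A] by blast
  have boxB: "NB \<subseteq> {..<m} \<times> {..<q}" using NB(2) support_carrier[OF B] by blast
  obtain a where aA: "eval_mat a A = indicator_mat m p NA" and aB: "eval_mat a B = indicator_mat m q NB"
    and aM: "eval_mat a (bip_join A B) = bip_join (indicator_mat m p NA) (indicator_mat m q NB)"
    by (rule bip_indicator[OF assms NA(2) NB(2)])
  note J = join_matching[OF NA(1) boxA NB(1) boxB]
  have snd: "inj_on snd NA" "inj_on snd NB" using NA(1) NB(1) by (simp_all add: matching_def)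
  obtain dA where dA: "eval_mpoly a dA = 1"
    "\<And>b. eval_mpoly b dA \<noteq> 0 \<Longrightarrow> vec_space.rank m (eval_mat b A) = generic_rank A"
    by (rule generic_minor[OF A aA NA(1) order_refl snd(1) boxA NA(3)], rule that)
  obtain dB where dB: "eval_mpoly a dB = 1"
    "\<And>b. eval_mpoly b dB \<noteq> 0 \<Longrightarrow> vec_space.rank m (eval_mat b B) = generic_rank B"
    by (rule generic_minor[OF B aB NB(1) order_refl snd(2) boxB NB(3)], rule that)
  have cJ: "card (join_matching p NA NB) = generic_rank (bip_join A B)"
    using card_join_matching[OF NA(1) boxA NB(1) boxB] U by simp
  obtain dM where dM: "eval_mpoly a dM = 1"
    "\<And>b. eval_mpoly b dM \<noteq> 0 \<Longrightarrow> vec_space.rank m (eval_mat b (bip_join A B)) = generic_rank (bip_join A B)"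
    by (rule generic_minor[OF M aM[unfolded bip_join_indicator[OF boxA]] J(1,3,4,5) cJ], rule that)
  define f where "f = dA * dB * dM"
  have f: "eval_mpoly b f = eval_mpoly b dA * eval_mpoly b dB * eval_mpoly b dM" for b
    by (simp add: f_def eval_mpoly_mult)
  define Mgen where "Mgen = (indicator_mat m p NA :: 'a mat, indicator_mat m q NB :: 'a mat)"
  \<comment> \<open>All three minors equal 1 at the same point \<open>a\<close>, so their product
    does not vanish there.\<close>
  have fa: "eval_mpoly a f \<noteq> 0" unfolding f dA(1) dB(1) dM(1) by simp
  then have "f \<noteq> 0" by auto
  have "Mgen \<in> bip_family A B f"
    unfolding Mgen_def aA[symmetric] aB[symmetric] bip_family_def using fa by blast
  define r where "r = card (fst ` NA \<inter> fst ` NB)"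
  define s where "s = card (fst ` NA - fst ` NB)"
  define t where "t = card (fst ` NB - fst ` NA)"
  have can: "has_canonical_form m p q r s t Mgen"
    unfolding r_def s_def t_def Mgen_def by (rule matchings_canonical_form[OF NA(1) boxA NB(1) boxB])
  have ranks: "r' + s' = generic_rank A" "r' + t' = generic_rank B" "r' + s' + t' = generic_rank (bip_join A B)"
    if "has_canonical_form m p q r' s' t' Mgen" for r' s' t'
    using canonical_form_ranks[OF that[unfolded Mgen_def]] rank_indicator_matching[OF NA(1) boxA, where 'a='a]
      rank_indicator_matching[OF NB(1) boxB, where 'a='a] rank_join_indicator[OF NA(1) boxA NB(1) boxB, where 'a='a]
      NA(3) NB(3) U by simp_all
  note rst = ranks[OF can]
  \<comment> \<open>The equations form a nonsingular linear system: the first two minus the third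
    give \<open>r'\<close>, and then \<open>s'\<close> and \<open>t'\<close> follow.\<close>
  have uniq: "r' = r \<and> s' = s \<and> t' = t"
    if "r' + s' = generic_rank A" "r' + t' = generic_rank B" "r' + s' + t' = generic_rank (bip_join A B)" for r' s' t'
    using that rst by linarith
  have red: "bip_reduces m p q N Mgen" if N: "N \<in> bip_family A B f" for N
  proof -
    obtain b where b: "N = (eval_mat b A, eval_mat b B)" "eval_mpoly b f \<noteq> 0"
      using N by (auto simp: bip_family_def)
    note cA = eval_mat_carrier[OF A, of b] and cB = eval_mat_carrier[OF B, of b]
    have rk: "vec_space.rank m (eval_mat b A) = generic_rank A" "vec_space.rank m (eval_mat b B) = generic_rank B"
      "vec_space.rank m (bip_join (eval_mat b A) (eval_mat b B)) = generic_rank (bip_join A B)"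
      using dA(2) dB(2) dM(2) b(2) unfolding f eval_mat_bip_join[OF A B] by auto
    obtain r' s' t' where fits: "r' + s' + t' \<le> m" "r' + s' \<le> p" "r' + t' \<le> q"
      and red: "bip_reduces m p q (eval_mat b A, eval_mat b B) (canon_left m p r' s', canon_right m q r' s' t')"
      by (rule bip_normal_form[OF cA cB])
    \<comment> \<open>At \<open>b\<close> the ranks are the generic ones, and reduction preserves
      them; so the normal form of this member has the parameters of \<open>Mgen\<close>.\<close>
    have "r' = r \<and> s' = s \<and> t' = t"
      using bip_reduces_rank[OF red cA cB] canonical_ranks[OF fits, where 'a='a] rk by (intro uniq) simp_all
    then have "bip_reduces m p q (eval_mat b A, eval_mat b B) (canon_left m p r s, canon_right m q r s t)"
      using red by simp
    then show ?thesis
      unfolding b(1) Mgen_def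
      using canonical_form_reduces[OF can[unfolded Mgen_def]] cA cB by (rule bip_reduces_trans)
  qed
  have "\<exists>r s t. has_canonical_form m p q r s t Mgen \<and>
       r + s = generic_rank A \<and> r + t = generic_rank B \<and> r + s + t = generic_rank (bip_join A B) \<and>
       (\<forall>r' s' t'. has_canonical_form m p q r' s' t' Mgen \<longrightarrow> r' = r \<and> s' = s \<and> t' = t) \<and>
       (\<forall>r' s' t'. r' + s' = generic_rank A \<and> r' + t' = generic_rank B \<and>
          r' + s' + t' = generic_rank (bip_join A B) \<longrightarrow> r' = r \<and> s' = s \<and> t' = t)"
    by (rule exI[of _ r], rule exI[of _ s], rule exI[of _ t], intro conjI allI impI can rst)
       (metis ranks uniq)+
  then show ?thesis
    using \<open>f \<noteq> 0\<close> \<open>Mgen \<in> bip_family A B f\<close> red by (intro exI[of _ f] exI[of _ Mgen]) simp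
qed

end
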